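(* Let $S:\mathscr D(S)\subseteq\mathscr H\to\mathscr H$ be a densely defined semi-bounded symmetric operator, $S\ge-\omega$, on a real Hilbert space $\mathscr H$, which is not essentially self-adjoint; let $A_\circ$ be its Friedrichs extension, let $\mathscr H_\circ$ be $\mathscr D(A_\circ)$ with the graph norm, let $\tau:\mathscr H_\circ\to\mathfrak h$ be a continuous surjective linear map onto a Hilbert space $\mathfrak h$ such that $\mathscr D(S)=\mathrm{kernel}(\tau)$, and let $\Theta\subset\mathfrak h\times\mathfrak h$ be a maximal monotone relation. Let $\lambda_\circ>\omega$, and for $\lambda>\omega$ put $R^\circ_\lambda:=(A_\circ+\lambda)^{-1}$, $G_\lambda:=(\tau R^\circ_\lambda)^*:\mathfrak h\to\mathscr H$, $G_\circ:=G_{\lambda_\circ}$ and $M^\Theta_\lambda:=\Theta+(\lambda-\lambda_\circ)G_\circ^*G_\lambda$ (a maximal monotone relation for $\lambda\ge\lambda_\circ$). Then $$R^\Theta_\lambda:=R^\circ_\lambda+G_\lambda (M^\Theta_\lambda)^{-1}\circ G_\lambda^*,\qquad \lambda>\lambda_\circ,$$ is the resolvent $(A_\Theta+\lambda)^{-1}$ of a nonlinear maximal monotone operator $A_\Theta:\mathscr D(A_\Theta)\subseteq\mathscr H\to\mathscr H$ of type $\lambda_\circ$. This operator is given by $$\mathscr D(A_\Theta)=\{u\in\mathscr H:\ u=u_\circ+G_\circ\xi_u,\ u_\circ\in\mathscr D(A_\circ),\ (\xi_u,\tau u_\circ)\in\Theta\},$$ $$A_\Theta(u)=A_\circ u_\circ-\lambda_\circ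 G_\circ\xi_u .$$
   Context: $\mathscr H$ is a real Hilbert space with scalar product $\langle\cdot,\cdot\rangle$ and norm $\|\cdot\|$; $\mathfrak h$ is a real Hilbert space. The scalar product of $\mathscr H_\circ$ is $\langle u,v\rangle_\circ=\langle A_\circ u,A_\circ v\rangle+\langle u,v\rangle$. $R^\circ_\lambda$ is viewed as a bounded map $\mathscr H\to\mathscr H_\circ$, so $\tau R^\circ_\lambda:\mathscr H\to\mathfrak h$ is bounded and $G_\lambda$ is its Hilbert-space adjoint. A (single-valued, nonlinear) operator $A:\mathscr D(A)\subseteq\mathscr H\to\mathscr H$ is monotone of type $\omega'$ ($\omega'\in\mathbb R$) if $\langle A(u)-A(v),u-v\rangle\ge-\omega'\|u-v\|^2$ for all $u,v\in\mathscr D(A)$; it is maximal monotone of type $\omega'$ if moreover $\mathrm{range}(A+\lambda)=\mathscr H$ for some (equivalently any) $\lambda>\omega'$. A relation $\Theta\subset\mathfrak h\times\mathfrak h$ is monotone if $[\tilde\xi-\tilde\zeta,\xi-\zeta]\ge0$ for all $(\xi,\tilde\xi),(\zeta,\tilde\zeta)\in\Theta$ (where $[\cdot,\cdot]$ is the scalar product of $\mathfrak h$), and maximal monotone if it is not properly contained in another monotone relation. For a relation $\Theta$ and an everywhere-defined operator $B$, $\Theta+B:=\{(\xi,\tilde\xi+B\xi):(\xi,\tilde\xi)\in\Theta\}$; the inverse relation is $\Theta^{-1}=\{(\tilde\xi,\xi):(\xi,\tilde\xi)\in\Theta\}$. Part of the assertion is that for $\lambda>\lambda_\circ$ the relation $(M^\Theta_\lambda)^{-1}$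 is the graph of a single-valued map $\mathfrak h\to\mathfrak h$, so that $R^\Theta_\lambda$ is a well-defined map $\mathscr H\to\mathscr H$. *)

theory Defs
  imports "HOL-Analysis.Analysis"
begin

text \<open>
  A real Hilbert space is a type of class \<open>{real_inner, complete_space}\<close>. Operators and relations,
  linear or not, are given by their graphs; the domain of \<open>A\<close> is \<open>Domain A\<close>.
\<close>

text \<open>Only meaningful if \<open>A\<close> contains exactly one pair with first component \<open>u\<close>.\<close>

definition rel_app :: "('a \<times> 'b) set \<Rightarrow> 'a \<Rightarrow> 'b" where
  "rel_app A u = (THE w. (u, w) \<in> A)"

definition rel_plus :: "('a \<times> 'b::plus) set \<Rightarrow> ('a \<Rightarrow> 'b) \<Rightarrow> ('a \<times> 'b) set" where
  "rel_plus A B = {(u, w + B u) | u w. (u, w) \<in> A}"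

subsection \<open>Linear operators\<close>

definition linear_operator :: "('a::real_vector \<times> 'b::real_vector) set \<Rightarrow> bool" where
  "linear_operator A \<longleftrightarrow> subspace A \<and> single_valued A"

definition densely_defined :: "('a::topological_space \<times> 'b) set \<Rightarrow> bool" where
  "densely_defined A \<longleftrightarrow> closure (Domain A) = UNIV"

definition symmetric_operator :: "('a::real_inner \<times> 'a) set \<Rightarrow> bool" where
  "symmetric_operator A \<longleftrightarrow> (\<forall>(u, w) \<in> A. \<forall>(v, z) \<in> A. w \<bullet> v = u \<bullet> z)"

definition bounded_below :: "real \<Rightarrow> ('a::real_inner \<times> 'a) set \<Rightarrow> bool" where
  "bounded_below c A \<longleftrightarrow> (\<forall>(u, w) \<in> A. w \<bullet> u \<ge> c * (norm u)\<^sup>2)"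

definition operator_adjoint :: "('a::real_inner \<times> 'b::real_inner) set \<Rightarrow> ('b \<times> 'a) set" where
  "operator_adjoint A = {(v, z). \<forall>(u, w) \<in> A. w \<bullet> v = u \<bullet> z}"

definition selfadjoint_operator :: "('a::real_inner \<times> 'a) set \<Rightarrow> bool" where
  "selfadjoint_operator A \<longleftrightarrow> linear_operator A \<and> densely_defined A \<and> operator_adjoint A = A"

definition essentially_selfadjoint :: "('a::real_inner \<times> 'a) set \<Rightarrow> bool" where
  "essentially_selfadjoint A \<longleftrightarrow> selfadjoint_operator (closure A)"

subsection \<open>The Friedrichs extension\<close>

text \<open>
  The Friedrichs extension of \<open>A\<close> is the operator associated with the closure of the form
  \<open>q(u, v) = \<langle>A u, v\<rangle>\<close> on \<open>Domain A\<close>. Following Kato, \<open>s\<close> is \<open>q\<close>-convergent to \<open>u\<close> if \<open>s n \<longlonglongrightarrow> u\<close> in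
  the Hilbert space and \<open>q(s m - s n, s m - s n) \<longlonglongrightarrow> 0\<close> as \<open>m, n \<longlonglongrightarrow> \<infinity>\<close>; if \<open>q\<close> is bounded below,
  this says that \<open>s n \<longlonglongrightarrow> u\<close> and that \<open>s\<close> is Cauchy for the form norm.
\<close>

definition form_convergent :: "('a::real_inner \<times> 'a) set \<Rightarrow> (nat \<Rightarrow> 'a) \<Rightarrow> 'a \<Rightarrow> bool" where
  "form_convergent A s u \<longleftrightarrow> range s \<subseteq> Domain A \<and> s \<longlonglongrightarrow> u \<and>
     ((\<lambda>(m, n). rel_app A (s m - s n) \<bullet> (s m - s n)) \<longlongrightarrow> 0) (sequentially \<times>\<^sub>F sequentially)"

definition closed_form_domain :: "('a::real_inner \<times> 'a) set \<Rightarrow> 'a set" where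
  "closed_form_domain A = {u. \<exists>s. form_convergent A s u}"

definition closed_form :: "('a::real_inner \<times> 'a) set \<Rightarrow> 'a \<Rightarrow> 'a \<Rightarrow> real" where
  "closed_form A u v = (THE l. \<forall>s t. form_convergent A s u \<longrightarrow> form_convergent A t v \<longrightarrow>
     (\<lambda>n. rel_app A (s n) \<bullet> t n) \<longlonglongrightarrow> l)"

definition Friedrichs_extension :: "('a::real_inner \<times> 'a) set \<Rightarrow> ('a \<times> 'a) set" where
  "Friedrichs_extension A = {(u, w). u \<in> closed_form_domain A \<and>
     (\<forall>v \<in> closed_form_domain A. closed_form A u v = w \<bullet> v)}"

subsection \<open>The Hilbert space \<open>Domain A\<close> with the graph norm\<close>

definition graph_inner :: "('a::real_inner \<times> 'a) set \<Rightarrow> 'a \<Rightarrow> 'a \<Rightarrow> real" where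
  "graph_inner A u v = rel_app A u \<bullet> rel_app A v + u \<bullet> v"

definition graph_norm :: "('a::real_inner \<times> 'a) set \<Rightarrow> 'a \<Rightarrow> real" where
  "graph_norm A u = sqrt (graph_inner A u u)"

definition graph_topology :: "('a::real_inner \<times> 'a) set \<Rightarrow> 'a topology" where
  "graph_topology A = Metric_space.mtopology (Domain A) (\<lambda>u v. graph_norm A (u - v))"

definition linear_on_subspace :: "'a::real_vector set \<Rightarrow> ('a \<Rightarrow> 'b::real_vector) \<Rightarrow> bool" where
  "linear_on_subspace D f \<longleftrightarrow>
     (\<forall>u \<in> D. \<forall>v \<in> D. f (u + v) = f u + f v) \<and> (\<forall>c. \<forall>u \<in> D. f (c *\<^sub>R u) = c *\<^sub>R f u)"

subsection \<open>Monotone relations and operators\<close>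

definition monotone_relation :: "('b::real_inner \<times> 'b) set \<Rightarrow> bool" where
  "monotone_relation \<Theta> \<longleftrightarrow> (\<forall>(x, x') \<in> \<Theta>. \<forall>(z, z') \<in> \<Theta>. (x' - z') \<bullet> (x - z) \<ge> 0)"

definition maximal_monotone_relation :: "('b::real_inner \<times> 'b) set \<Rightarrow> bool" where
  "maximal_monotone_relation \<Theta> \<longleftrightarrow>
     monotone_relation \<Theta> \<and> (\<nexists>\<Phi>. monotone_relation \<Phi> \<and> \<Theta> \<subset> \<Phi>)"

definition monotone_operator_of_type :: "real \<Rightarrow> ('a::real_inner \<times> 'a) set \<Rightarrow> bool" where
  "monotone_operator_of_type \<omega> A \<longleftrightarrow> single_valued A \<and>
     (\<forall>(u, u') \<in> A. \<forall>(v, v') \<in> A. (u' - v') \<bullet> (u - v) \<ge> - \<omega> * (norm (u - v))\<^sup>2)"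

definition maximal_monotone_operator_of_type :: "real \<Rightarrow> ('a::real_inner \<times> 'a) set \<Rightarrow> bool" where
  "maximal_monotone_operator_of_type \<omega> A \<longleftrightarrow> monotone_operator_of_type \<omega> A \<and>
     (\<exists>l > \<omega>. Range (rel_plus A (\<lambda>u. l *\<^sub>R u)) = UNIV)"

subsection \<open>Resolvents\<close>

definition resolvent_relation :: "('a::real_vector \<times> 'a) set \<Rightarrow> real \<Rightarrow> ('a \<times> 'a) set" where
  "resolvent_relation A l = (rel_plus A (\<lambda>u. l *\<^sub>R u))\<inverse>"

definition resolvent :: "('a::real_vector \<times> 'a) set \<Rightarrow> real \<Rightarrow> 'a \<Rightarrow> 'a" where
  "resolvent A l = rel_app (resolvent_relation A l)"

text \<open>
  In the following, \<open>A\<close> is the linear operator \<open>A\<^sub>\<circ>\<close> and \<open>\<tau>\<close> matters only on \<open>Domain A\<close>. The library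
  constant \<^const>\<open>adjoint\<close> is the Hilbert space adjoint of an everywhere defined bounded linear map.
\<close>

definition G_map ::
  "('a::real_inner \<times> 'a) set \<Rightarrow> ('a \<Rightarrow> 'b::real_inner) \<Rightarrow> real \<Rightarrow> 'b \<Rightarrow> 'a" where
  "G_map A \<tau> l = adjoint (\<tau> \<circ> resolvent A l)"

definition M_relation ::
  "('a::real_inner \<times> 'a) set \<Rightarrow> ('a \<Rightarrow> 'b::real_inner) \<Rightarrow> ('b \<times> 'b) set \<Rightarrow> real \<Rightarrow> real \<Rightarrow> ('b \<times> 'b) set"
  where "M_relation A \<tau> \<Theta> l0 l =
    rel_plus \<Theta> (\<lambda>\<xi>. (l - l0) *\<^sub>R adjoint (G_map A \<tau> l0) (G_map A \<tau> l \<xi>))"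

definition R_map ::
  "('a::real_inner \<times> 'a) set \<Rightarrow> ('a \<Rightarrow> 'b::real_inner) \<Rightarrow> ('b \<times> 'b) set \<Rightarrow> real \<Rightarrow> real \<Rightarrow> 'a \<Rightarrow> 'a"
  where "R_map A \<tau> \<Theta> l0 l f = resolvent A l f +
    G_map A \<tau> l (rel_app ((M_relation A \<tau> \<Theta> l0 l)\<inverse>) (adjoint (G_map A \<tau> l) f))"

definition A_operator ::
  "('a::real_inner \<times> 'a) set \<Rightarrow> ('a \<Rightarrow> 'b::real_inner) \<Rightarrow> ('b \<times> 'b) set \<Rightarrow> real \<Rightarrow> ('a \<times> 'a) set"
  where "A_operator A \<tau> \<Theta> l0 =
    {(u0 + G_map A \<tau> l0 \<xi>, rel_app A u0 - l0 *\<^sub>R G_map A \<tau> l0 \<xi>) | u0 \<xi>.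
       u0 \<in> Domain A \<and> (\<xi>, \<tau> u0) \<in> \<Theta>}"

end

theory Submission
  imports Defs
begin

text \<open>
  With \<open>v = R\<^sub>l (G\<^sub>\<circ> \<xi>)\<close> the resolvent identity reads \<open>G\<^sub>l \<xi> = G\<^sub>\<circ> \<xi> - (l - l\<^sub>\<circ>) v = (A\<^sub>\<circ> + l\<^sub>\<circ>) v\<close>, so
  \<open>\<langle>G\<^sub>\<circ>\<^sup>* G\<^sub>l \<xi>, \<xi>\<rangle> \<ge> \<parallel>G\<^sub>l \<xi>\<parallel>\<^sup>2\<close>. As \<open>\<tau> R\<^sub>l\<close> is onto, its adjoint \<open>G\<^sub>l\<close> is bounded below, hence \<open>M\<^sub>l\<close> is, for
  \<open>l > l\<^sub>\<circ>\<close>, a maximal monotone relation plus a coercive bounded operator; Minty's theorem and the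
  contraction principle make it a bijection. For \<open>\<xi> = M\<^sub>l\<^sup>-\<^sup>1 G\<^sub>l\<^sup>* f\<close> the resolvent identity turns
  \<open>R\<^sub>l f + G\<^sub>l \<xi>\<close> into \<open>u\<^sub>\<circ> + G\<^sub>\<circ> \<xi>\<close> with \<open>(\<xi>, \<tau> u\<^sub>\<circ>) \<in> \<Theta>\<close>, which solves \<open>(A\<^sub>\<Theta> + l) u = f\<close>. The solution is unique as
  \<open>\<langle>(A\<^sub>\<circ> + l\<^sub>\<circ>) u\<^sub>\<circ>, G\<^sub>\<circ> \<xi>\<rangle> = [\<tau> u\<^sub>\<circ>, \<xi>]\<close> makes \<open>A\<^sub>\<Theta> + l\<^sub>\<circ>\<close> monotone. Density of the kernel of \<open>\<tau>\<close> gives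
  \<open>range G\<^sub>\<circ> \<inter> \<D>(A\<^sub>\<circ>) = 0\<close>, so \<open>A\<^sub>\<Theta>\<close> is single-valued. Of the Friedrichs extension only symmetry, the
  lower bound and the surjectivity of \<open>A\<^sub>\<circ> + l\<close> are needed.
\<close>

subsection \<open>Coercive symmetric forms, Riesz representation and adjoints\<close>

text \<open>Evaluation at the vertex \<open>t = - b / q\<close> of the parabola. Serves to bound the
  first variation of a functional at an approximate minimiser.\<close>

lemma quadratic_nonneg_discriminant:
  fixes a b q :: real
  assumes pos: "\<And>t. 0 \<le> a + t * b + t\<^sup>2 / 2 * q" and q: "0 < q"
  shows "b\<^sup>2 \<le> 2 * a * q"
proof -
  have "(- b / q) * b + (- b / q)\<^sup>2 / 2 * q = - (b\<^sup>2 / (2 * q))"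
    using q by (simp add: field_simps power2_eq_square)
  then have "b\<^sup>2 / (2 * q) \<le> a"
    using pos[of "- b / q"] by linarith
  then show ?thesis using q by (simp add: field_simps)
qed

section \<open>The energy norm of a coercive symmetric operator\<close>

text \<open>Two instances are used: the identity on the whole space, which yields the Riesz
  representation theorem, and \<open>S + l\<close> on \<open>Domain S\<close> with
  \<open>l > \<omega>\<close>, which yields the Friedrichs extension.\<close>

locale coercive_operator =
  fixes D :: "'a::{real_inner,complete_space} set" and T :: "'a \<Rightarrow> 'a" and c :: real
  assumes subspace_D: "subspace D"
    and T_linear: "linear_on_subspace D T"
    and T_symmetric: "\<lbrakk>u \<in> D; v \<in> D\<rbrakk> \<Longrightarrow> T u \<bullet> v = u \<bullet> T v"
    and T_coercive: "u \<in> D \<Longrightarrow> c * (norm u)\<^sup>2 \<le> T u \<bullet> u"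
    and c_pos: "0 < c"
begin

definition en :: "'a \<Rightarrow> real" where "en u = sqrt (T u \<bullet> u)"

text \<open>The limit \<open>u\<close> may lie outside \<open>D\<close>: such limits form the
  completion of \<open>D\<close> in the energy norm, realised inside the Hilbert space.\<close>

definition en_convergent :: "(nat \<Rightarrow> 'a) \<Rightarrow> 'a \<Rightarrow> bool" where
  "en_convergent s u \<longleftrightarrow> range s \<subseteq> D \<and> s \<longlonglongrightarrow> u \<and>
     (\<forall>e>0. \<exists>N. \<forall>m\<ge>N. \<forall>n\<ge>N. en (s m - s n) < e)"

lemma D_add: "u \<in> D \<Longrightarrow> v \<in> D \<Longrightarrow> u + v \<in> D"
  and D_diff: "u \<in> D \<Longrightarrow> v \<in> D \<Longrightarrow> u - v \<in> D"
  and D_scale: "u \<in> D \<Longrightarrow> r *\<^sub>R u \<in> D"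
  and D_0: "0 \<in> D"
  using subspace_D by (auto simp: subspace_add subspace_diff subspace_scale subspace_0)

lemma T_add: "u \<in> D \<Longrightarrow> v \<in> D \<Longrightarrow> T (u + v) = T u + T v"
  and T_scale: "u \<in> D \<Longrightarrow> T (r *\<^sub>R u) = r *\<^sub>R T u"
  using T_linear by (auto simp: linear_on_subspace_def)

lemma T_diff: "u \<in> D \<Longrightarrow> v \<in> D \<Longrightarrow> T (u - v) = T u - T v"
  using T_add[of u "(-1) *\<^sub>R v"] T_scale[of v "-1"] D_scale[of v "-1"] by simp

lemma T_pos: "u \<in> D \<Longrightarrow> 0 \<le> T u \<bullet> u"
  using T_coercive[of u] c_pos by (smt (verit) zero_le_mult_iff zero_le_power2)

lemma en_nonneg: "u \<in> D \<Longrightarrow> 0 \<le> en u"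
  by (simp add: en_def T_pos)

lemma en_square: "u \<in> D \<Longrightarrow> (en u)\<^sup>2 = T u \<bullet> u"
  by (simp add: en_def T_pos)

lemma norm_le_en: "u \<in> D \<Longrightarrow> sqrt c * norm u \<le> en u"
  using real_sqrt_le_mono[OF T_coercive[of u]] c_pos by (simp add: en_def real_sqrt_mult)

lemma en_Cauchy_Schwarz:
  assumes "u \<in> D" "v \<in> D" shows "\<bar>T u \<bullet> v\<bar> \<le> en u * en v"
proof -
  have expand: "T (u + t *\<^sub>R v) \<bullet> (u + t *\<^sub>R v) = T u \<bullet> u + 2 * t * (T u \<bullet> v) + t\<^sup>2 * (T v \<bullet> v)" for t
    using assms T_symmetric[OF assms(2) assms(1)]
    by (simp add: T_add T_scale D_scale inner_add power2_eq_square inner_commute algebra_simps)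
  have pos: "0 \<le> T u \<bullet> u + 2 * t * (T u \<bullet> v) + t\<^sup>2 * (T v \<bullet> v)" for t
    unfolding expand[symmetric] using assms by (intro T_pos D_add D_scale)
  have "(T u \<bullet> v)\<^sup>2 \<le> (T u \<bullet> u) * (T v \<bullet> v)"
  proof (cases "v = 0")
    case False
    then have q: "0 < T v \<bullet> v" 
      using T_coercive[OF assms(2)] c_pos by (smt (verit) zero_less_mult_iff zero_less_norm_iff zero_less_power)
    \<comment> \<open>The discriminant inequality, read off at the minimiser of the quadratic in
      \<open>t\<close>.\<close>
    show ?thesis
      using pos[of "- (T u \<bullet> v) / (T v \<bullet> v)"] q by (simp add: field_simps power2_eq_square)
  qed simp
  also have "\<dots> = (en u * en v)\<^sup>2" using assms by (simp add: en_square power_mult_distrib)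
  finally show ?thesis
    using assms en_nonneg by (simp add: abs_le_square_iff[symmetric])
qed

lemma en_triangle:
  assumes "u \<in> D" "v \<in> D" shows "en (u + v) \<le> en u + en v"
proof (rule power2_le_imp_le)
  have "(en (u + v))\<^sup>2 = (en u)\<^sup>2 + 2 * (T u \<bullet> v) + (en v)\<^sup>2"
    using assms T_symmetric[OF assms(2) assms(1)]
    by (simp add: en_square T_add D_add inner_add inner_commute)
  then show "(en (u + v))\<^sup>2 \<le> (en u + en v)\<^sup>2"
    using en_Cauchy_Schwarz[OF assms] by (simp add: power2_sum)
  show "0 \<le> en u + en v" using assms by (simp add: en_nonneg)
qed

lemma en_scale: "u \<in> D \<Longrightarrow> en (r *\<^sub>R u) = \<bar>r\<bar> * en u"
proof -
  assume "u \<in> D"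
  then have "T (r *\<^sub>R u) \<bullet> (r *\<^sub>R u) = r\<^sup>2 * (T u \<bullet> u)"
    by (simp add: T_scale power2_eq_square)
  then show ?thesis by (simp add: en_def real_sqrt_mult)
qed

lemma en_convergent_add:
  assumes "en_convergent s u" "en_convergent t v"
  shows "en_convergent (\<lambda>n. s n + t n) (u + v)"
  unfolding en_convergent_def
proof (intro conjI allI impI)
  show "range (\<lambda>n. s n + t n) \<subseteq> D" "(\<lambda>n. s n + t n) \<longlonglongrightarrow> u + v"
    using assms by (auto simp: en_convergent_def image_subset_iff intro!: D_add tendsto_add)
  fix e :: real assume "e > 0"
  then obtain N1 N2 where N: "\<And>m n. m \<ge> N1 \<Longrightarrow> n \<ge> N1 \<Longrightarrow> en (s m - s n) < e / 2"
    "\<And>m n. m \<ge> N2 \<Longrightarrow> n \<ge> N2 \<Longrightarrow> en (t m - t n) < e / 2"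
    using assms unfolding en_convergent_def by (meson half_gt_zero)
  have "en (s m + t m - (s n + t n)) < e" if "m \<ge> max N1 N2" "n \<ge> max N1 N2" for m n
  proof -
    have "en (s m + t m - (s n + t n)) \<le> en (s m - s n) + en (t m - t n)"
      using en_triangle[of "s m - s n" "t m - t n"] assms
      by (auto simp: en_convergent_def image_subset_iff D_diff algebra_simps)
    then show ?thesis using N(1)[of m n] N(2)[of m n] that by simp
  qed
  then show "\<exists>N. \<forall>m\<ge>N. \<forall>n\<ge>N. en (s m + t m - (s n + t n)) < e" by blast
qed

lemma en_convergent_scale:
  assumes "en_convergent s u"
  shows "en_convergent (\<lambda>n. r *\<^sub>R s n) (r *\<^sub>R u)"
  unfolding en_convergent_def
proof (intro conjI allI impI)
  show "range (\<lambda>n. r *\<^sub>R s n) \<subseteq> D" "(\<lambda>n. r *\<^sub>R s n) \<longlonglongrightarrow> r *\<^sub>R u"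
    using assms by (auto simp: en_convergent_def image_subset_iff intro!: D_scale tendsto_intros)
  fix e :: real assume "e > 0"
  then have "0 < e / (\<bar>r\<bar> + 1)" by simp
  then obtain N where N: "\<And>m n. m \<ge> N \<Longrightarrow> n \<ge> N \<Longrightarrow> en (s m - s n) < e / (\<bar>r\<bar> + 1)"
    using assms unfolding en_convergent_def by meson
  have "en (r *\<^sub>R s m - r *\<^sub>R s n) < e" if "m \<ge> N" "n \<ge> N" for m n
  proof -
    have D: "s m - s n \<in> D" using assms by (auto simp: en_convergent_def image_subset_iff D_diff)
    have "en (r *\<^sub>R s m - r *\<^sub>R s n) = \<bar>r\<bar> * en (s m - s n)"
      using en_scale[OF D] by (simp add: scaleR_diff_right)
    also have "\<dots> \<le> (\<bar>r\<bar> + 1) * en (s m - s n)" using en_nonneg[OF D] by (simp add: algebra_simps)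
    also have "\<dots> < e" using N[OF that] by (simp add: field_simps)
    finally show ?thesis .
  qed
  then show "\<exists>N. \<forall>m\<ge>N. \<forall>n\<ge>N. en (r *\<^sub>R s m - r *\<^sub>R s n) < e" by blast
qed

lemma en_convergent_diff:
  assumes "en_convergent s u" "en_convergent t v"
  shows "en_convergent (\<lambda>n. s n - t n) (u - v)"
proof -
  have "(\<lambda>n. s n - t n) = (\<lambda>n. s n + (-1) *\<^sub>R t n)" "u - v = u + (-1) *\<^sub>R v" by auto
  then show ?thesis using en_convergent_add[OF assms(1) en_convergent_scale[OF assms(2)]] by metis
qed

lemma en_convergent_const: "u \<in> D \<Longrightarrow> en_convergent (\<lambda>_. u) u"
  using T_scale[of 0 0] D_0 by (auto simp: en_convergent_def en_def)

lemma en_convergent_bounded: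
  assumes "en_convergent s u"
  obtains B where "0 < B" "\<And>n. en (s n) \<le> B"
proof -
  have D: "s n \<in> D" for n using assms by (auto simp: en_convergent_def)
  obtain N where N: "\<And>m n. m \<ge> N \<Longrightarrow> n \<ge> N \<Longrightarrow> en (s m - s n) < 1"
    using assms unfolding en_convergent_def by (meson zero_less_one)
  \<comment> \<open>The sum dominates each of the finitely many early energy norms; the
    \<open>1\<close> accounts for the tail.\<close>
  define B where "B = (\<Sum>k\<le>N. en (s k)) + 1"
  have le: "en (s k) \<le> (\<Sum>k\<le>N. en (s k))" if "k \<le> N" for k
    using that by (intro member_le_sum) (auto simp: en_nonneg D)
  have "en (s n) \<le> B" for n
  proof (cases "n \<le> N")
    case True then show ?thesis using le[of n] by (simp add: B_def)
  next
    case False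
    have "en (s n) \<le> en (s n - s N) + en (s N)" 
      using en_triangle[of "s n - s N" "s N"] D by (simp add: D_diff)
    then show ?thesis using N[of n N] False le[of N] by (simp add: B_def)
  qed
  moreover have "0 < B" using le[of 0] en_nonneg[OF D[of 0]] by (simp add: B_def)
  ultimately show ?thesis using that by blast
qed

text \<open>Closability of the form: it is induced by an operator, so \<open>T (s n) \<bullet> s m \<longlonglongrightarrow> 0\<close> as \<open>m \<longlonglongrightarrow> \<infinity>\<close> for fixed \<open>n\<close>.\<close>

lemma en_convergent_0:
  assumes "en_convergent s 0"
  shows "(\<lambda>n. en (s n)) \<longlonglongrightarrow> 0"
proof -
  have D: "s n \<in> D" for n using assms by (auto simp: en_convergent_def)
  have "\<exists>N. \<forall>n\<ge>N. norm (en (s n) - 0) < e" if "e > 0" for e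
  proof -
    obtain N where N: "\<And>m n. m \<ge> N \<Longrightarrow> n \<ge> N \<Longrightarrow> en (s m - s n) < e / 2"
      using assms \<open>e > 0\<close> unfolding en_convergent_def by (meson half_gt_zero)
    have "en (s n) < e" if n: "n \<ge> N" for n
    proof -
      have "(\<lambda>m. T (s n) \<bullet> s m) \<longlonglongrightarrow> T (s n) \<bullet> 0"
        by (intro tendsto_intros) (use assms in \<open>simp add: en_convergent_def\<close>)
      then have lim: "(\<lambda>m. en (s n) * (e / 2) + T (s n) \<bullet> s m) \<longlonglongrightarrow> en (s n) * (e / 2) + T (s n) \<bullet> 0"
        by (intro tendsto_add tendsto_const)
      have "(en (s n))\<^sup>2 \<le> en (s n) * (e / 2) + T (s n) \<bullet> 0"
      proof (rule tendsto_lowerbound[OF lim])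
        show "\<forall>\<^sub>F m in sequentially. (en (s n))\<^sup>2 \<le> en (s n) * (e / 2) + T (s n) \<bullet> s m"
          unfolding eventually_sequentially
        proof (intro exI[of _ N] allI impI)
          fix m assume m: "m \<ge> N"
          have "(en (s n))\<^sup>2 = T (s n) \<bullet> (s n - s m) + T (s n) \<bullet> s m"
            by (simp add: en_square D inner_diff)
          also have "T (s n) \<bullet> (s n - s m) \<le> en (s n) * en (s n - s m)"
            using en_Cauchy_Schwarz[OF D[of n] D_diff[OF D[of n] D[of m]]] by linarith
          also have "\<dots> \<le> en (s n) * (e / 2)"
            using N[OF n m] by (intro mult_left_mono en_nonneg D) auto
          finally show "(en (s n))\<^sup>2 \<le> en (s n) * (e / 2) + T (s n) \<bullet> s m" by simp
        qed
      qed simp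
      then have "en (s n) * en (s n) \<le> en (s n) * (e / 2)" by (simp add: power2_eq_square)
      then have "en (s n) \<le> e / 2" 
        using en_nonneg[OF D[of n]] \<open>e > 0\<close> by (cases "en (s n) = 0") (auto simp: mult_le_cancel_left)
      then show ?thesis using \<open>e > 0\<close> by simp
    qed
    then show ?thesis using en_nonneg[OF D] by auto
  qed
  then show ?thesis unfolding LIMSEQ_iff by blast
qed

text \<open>Cauchy-Schwarz for the energy: \<open>en (s n)\<close> tends to 0 while
  \<open>en (t n)\<close> stays bounded.\<close>

lemma form_limit_0:
  assumes "en_convergent s 0" "en_convergent t v"
  shows "(\<lambda>n. T (s n) \<bullet> t n) \<longlonglongrightarrow> 0"
proof -
  obtain B where B: "0 < B" "\<And>n. en (t n) \<le> B" using en_convergent_bounded[OF assms(2)] by blast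
  have D: "s n \<in> D" "t n \<in> D" for n using assms by (auto simp: en_convergent_def)
  have "(\<lambda>n. en (s n) * B) \<longlonglongrightarrow> 0 * B" by (intro tendsto_intros en_convergent_0 assms)
  then have lim: "(\<lambda>n. en (s n) * B) \<longlonglongrightarrow> 0" by (simp only: mult_zero_left)
  have le: "norm (T (s n) \<bullet> t n) \<le> en (s n) * B" for n
    using en_Cauchy_Schwarz[OF D, of n n] mult_left_mono[OF B(2)[of n] en_nonneg[OF D(1)[of n]]] by simp
  show ?thesis by (rule Lim_null_comparison[OF always_eventually lim]) (use le in blast)
qed

lemma form_Cauchy:
  assumes "en_convergent s u" "en_convergent t v"
  shows "convergent (\<lambda>n. T (s n) \<bullet> t n)"
proof (rule Cauchy_convergent, rule metric_CauchyI)
  have D: "s n \<in> D" "t n \<in> D" for n using assms by (auto simp: en_convergent_def)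
  obtain B where B: "0 < B" "\<And>n. en (t n) \<le> B" using en_convergent_bounded[OF assms(2)] by blast
  obtain C where C: "0 < C" "\<And>n. en (s n) \<le> C" using en_convergent_bounded[OF assms(1)] by blast
  fix e :: real assume "e > 0"
  then have "0 < e / (2 * B)" "0 < e / (2 * C)" using B C by auto
  then obtain N1 N2 where N: "\<And>m n. m \<ge> N1 \<Longrightarrow> n \<ge> N1 \<Longrightarrow> en (s m - s n) < e / (2 * B)"
    "\<And>m n. m \<ge> N2 \<Longrightarrow> n \<ge> N2 \<Longrightarrow> en (t m - t n) < e / (2 * C)"
    using assms unfolding en_convergent_def by meson
  have "dist (T (s m) \<bullet> t m) (T (s n) \<bullet> t n) < e" if "m \<ge> max N1 N2" "n \<ge> max N1 N2" for m n
  proof -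
    have "T (s m) \<bullet> t m - T (s n) \<bullet> t n = T (s m - s n) \<bullet> t m + T (s n) \<bullet> (t m - t n)"
      by (simp add: T_diff D inner_diff)
    moreover have "\<bar>T (s m - s n) \<bullet> t m\<bar> \<le> en (s m - s n) * en (t m)"
      by (intro en_Cauchy_Schwarz D D_diff)
    moreover have "en (s m - s n) * en (t m) \<le> en (s m - s n) * B"
      by (intro mult_left_mono B en_nonneg D_diff D)
    moreover have "en (s m - s n) * B < e / 2" 
      using N(1)[of m n] that B by (simp add: field_simps)
    moreover have "\<bar>T (s n) \<bullet> (t m - t n)\<bar> \<le> en (s n) * en (t m - t n)"
      by (intro en_Cauchy_Schwarz D D_diff)
    moreover have "en (s n) * en (t m - t n) \<le> C * en (t m - t n)"
      by (intro mult_right_mono C en_nonneg D_diff D)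
    moreover have "C * en (t m - t n) < e / 2" 
      using N(2)[of m n] that C by (simp add: field_simps)
    ultimately show ?thesis unfolding dist_real_def by linarith
  qed
  then show "\<exists>M. \<forall>m\<ge>M. \<forall>n\<ge>M. dist (T (s m) \<bullet> t m) (T (s n) \<bullet> t n) < e" by blast
qed

text \<open>Two sequences with the same limit differ by an energy-null one, by closability, and such
  a sequence contributes nothing in either slot; symmetry reduces the second slot to the
  first.\<close>

lemma form_limit_unique:
  assumes "en_convergent s u" "en_convergent s' u" "en_convergent t v" "en_convergent t' v"
    and lim: "(\<lambda>n. T (s n) \<bullet> t n) \<longlonglongrightarrow> l"
  shows "(\<lambda>n. T (s' n) \<bullet> t' n) \<longlonglongrightarrow> l"
proof -
  have D: "s n \<in> D" "t n \<in> D" "s' n \<in> D" "t' n \<in> D" for n using assms by (auto simp: en_convergent_def)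
  have 1: "(\<lambda>n. T (s' n - s n) \<bullet> t' n) \<longlonglongrightarrow> 0"
    using en_convergent_diff[OF assms(2,1)] assms(4) by (intro form_limit_0) auto
  have 2: "(\<lambda>n. T (t' n - t n) \<bullet> s n) \<longlonglongrightarrow> 0"
    using en_convergent_diff[OF assms(4,3)] assms(1) by (intro form_limit_0) auto
  have "T (s' n) \<bullet> t' n = T (s' n - s n) \<bullet> t' n + T (t' n - t n) \<bullet> s n + T (s n) \<bullet> t n" for n
    using T_symmetric[OF D(2) D(1), of n n] T_symmetric[OF D(4) D(1), of n n]
    by (simp add: T_diff D inner_diff inner_commute)
  then show ?thesis using tendsto_add[OF tendsto_add[OF 1 2] lim] by simp
qed

section \<open>Minimisation of the energy functional\<close>

text \<open>Direct method: a minimising sequence of \<open>J\<close> is Cauchy in the energy norm by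
  the parallelogram identity, and approximate minimality makes the first variation
  \<open>T (s n) \<bullet> v - h v\<close> small. The limit may leave \<open>D\<close>, where
  \<open>T\<close> carries no information, so the Euler equation is stated along sequences.\<close>

lemma Riesz_sequence:
  fixes h :: "'a \<Rightarrow> real"
  assumes h: "linear_on_subspace D h" and K: "\<And>v. v \<in> D \<Longrightarrow> \<bar>h v\<bar> \<le> K * norm v"
  obtains s u where "en_convergent s u"
    "\<And>t v. en_convergent t v \<Longrightarrow> (\<lambda>n. T (s n) \<bullet> t n - h (t n)) \<longlonglongrightarrow> 0"
proof -
  define J where "J u = (T u \<bullet> u) / 2 - h u" for u
  have h_add: "h (u + v) = h u + h v" if "u \<in> D" "v \<in> D" for u v
    using h that by (auto simp: linear_on_subspace_def)
  have h_scale: "h (r *\<^sub>R u) = r * h u" if "u \<in> D" for u r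
    using h that by (auto simp: linear_on_subspace_def)
  \<comment> \<open>Completing the square: coercivity outweighs the linear term.\<close>
  have lower: "- (K\<^sup>2 / (2 * c)) \<le> J u" if "u \<in> D" for u
  proof -
    have "0 \<le> (c * norm u - K)\<^sup>2 / (2 * c)" using c_pos by simp
    also have "\<dots> = c * (norm u)\<^sup>2 / 2 - K * norm u + K\<^sup>2 / (2 * c)"
      using c_pos by (simp add: field_simps power2_eq_square)
    finally show ?thesis using T_coercive[OF that] K[OF that] unfolding J_def by linarith
  qed
  define m where "m = Inf (J ` D)"
  have bdd: "bdd_below (J ` D)" using lower by (auto intro!: bdd_belowI)
  have m: "m \<le> J u" if "u \<in> D" for u
    unfolding m_def using that bdd by (intro cInf_lower) auto
  have "\<exists>u. u \<in> D \<and> J u < m + inverse (real (Suc n))" for n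
  proof -
    have "J ` D \<noteq> {}" "Inf (J ` D) < m + inverse (real (Suc n))" using D_0 by (auto simp: m_def)
    from cInf_lessD[OF this] show ?thesis by blast
  qed
  then obtain s where "\<forall>n. s n \<in> D \<and> J (s n) < m + inverse (real (Suc n))"
    using choice[of "\<lambda>n u. u \<in> D \<and> J u < m + inverse (real (Suc n))"] by blast
  then have s: "\<And>n. s n \<in> D" "\<And>n. J (s n) < m + inverse (real (Suc n))" by auto
  \<comment> \<open>The midpoint of \<open>u\<close> and \<open>v\<close> is a competitor with value
    at least \<open>m\<close>; the parallelogram identity then isolates the energy of
    \<open>u - v\<close>.\<close>
  have par: "(en (u - v))\<^sup>2 \<le> 4 * (J u + J v - 2 * m)" if D: "u \<in> D" "v \<in> D" for u v
  proof -
    have "m \<le> J ((1/2) *\<^sub>R (u + v))" by (intro m D_scale D_add D)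
    also have "\<dots> = (T u \<bullet> u + 2 * (T u \<bullet> v) + T v \<bullet> v) / 8 - (h u + h v) / 2"
      using D T_symmetric[OF D(2) D(1)]
      by (simp add: J_def T_scale T_add D_add h_scale h_add inner_add inner_commute)
    finally have "2 * m \<le> (T u \<bullet> u + 2 * (T u \<bullet> v) + T v \<bullet> v) / 4 - (h u + h v)" by (simp add: field_simps)
    moreover have "(en (u - v))\<^sup>2 = T u \<bullet> u - 2 * (T u \<bullet> v) + T v \<bullet> v"
      using D T_symmetric[OF D(2) D(1)]
      by (simp add: en_square D_diff T_diff inner_diff inner_commute)
    ultimately show ?thesis unfolding J_def by (simp add: field_simps)
  qed
  \<comment> \<open>Perturbation by \<open>t *\<^sub>R v\<close> gives a nonnegative quadratic in
    \<open>t\<close>; its discriminant bounds the first variation by the defect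
    \<open>J u - m\<close>.\<close>
  have var: "(T u \<bullet> v - h v)\<^sup>2 \<le> 2 * (J u - m) * (en v)\<^sup>2" if D: "u \<in> D" "v \<in> D" for u v
  proof -
    have pos: "0 \<le> (J u - m) + t * (T u \<bullet> v - h v) + t\<^sup>2 / 2 * (T v \<bullet> v)" for t
    proof -
      have "m \<le> J (u + t *\<^sub>R v)" by (intro m D_scale D_add D)
      also have "\<dots> = J u + t * (T u \<bullet> v - h v) + t\<^sup>2 / 2 * (T v \<bullet> v)"
        using D T_symmetric[OF D(2) D(1)]
        by (simp add: J_def T_scale T_add D_scale h_scale h_add inner_add inner_commute power2_eq_square algebra_simps)
      finally show ?thesis by simp
    qed
    show ?thesis
    proof (cases "v = 0")
      case True then show ?thesis using h_scale[of 0 0] D_0 m[OF D(1)] by simp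
    next
      case False
      then have q: "0 < T v \<bullet> v" 
        using T_coercive[OF D(2)] c_pos by (smt (verit) zero_less_mult_iff zero_less_norm_iff zero_less_power)
      show ?thesis using quadratic_nonneg_discriminant[OF pos q] by (simp add: en_square D)
    qed
  qed
  have Cau: "\<exists>N. \<forall>m\<ge>N. \<forall>n\<ge>N. en (s m - s n) < e" if "e > 0" for e
  proof -
    \<comment> \<open>Two defects below \<open>e\<^sup>2 / 8\<close> enter \<open>par\<close> with
      the factor 4.\<close>
    have "0 < e\<^sup>2 / 8" using that by simp
    then obtain N where N: "\<And>n. n \<ge> N \<Longrightarrow> inverse (real (Suc n)) < e\<^sup>2 / 8"
      using LIMSEQ_inverse_real_of_nat[THEN LIMSEQ_D] by (metis abs_inverse abs_of_nat diff_zero real_norm_def)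
    have "en (s k - s n) < e" if "k \<ge> N" "n \<ge> N" for k n
    proof (rule power2_less_imp_less)
      show "(en (s k - s n))\<^sup>2 < e\<^sup>2"
        using par[OF s(1)[of k] s(1)[of n]] s(2)[of k] s(2)[of n] N[OF that(1)] N[OF that(2)] by argo
    qed (use \<open>e > 0\<close> in simp)
    then show ?thesis by blast
  qed
  have "Cauchy s"
  proof (rule metric_CauchyI)
    fix e :: real assume "e > 0"
    then obtain N where N: "\<And>m n. m \<ge> N \<Longrightarrow> n \<ge> N \<Longrightarrow> en (s m - s n) < sqrt c * e"
      using Cau[of "sqrt c * e"] c_pos by auto
    have "dist (s m) (s n) < e" if "m \<ge> N" "n \<ge> N" for m n
    proof -
      have "sqrt c * norm (s m - s n) < sqrt c * e"
        using norm_le_en[OF D_diff[OF s(1) s(1)], of m n] N[OF that] by linarith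
      then show ?thesis using c_pos by (simp add: dist_norm)
    qed
    then show "\<exists>M. \<forall>m\<ge>M. \<forall>n\<ge>M. dist (s m) (s n) < e" by blast
  qed
  then obtain u where "s \<longlonglongrightarrow> u" using Cauchy_convergent convergent_def by blast
  then have "en_convergent s u" using s(1) Cau by (auto simp: en_convergent_def)
  moreover have "(\<lambda>n. T (s n) \<bullet> t n - h (t n)) \<longlonglongrightarrow> 0" if t: "en_convergent t v" for t v
  proof -
    obtain B where B: "0 < B" "\<And>n. en (t n) \<le> B" using en_convergent_bounded[OF t] by blast
    have D: "t n \<in> D" for n using t by (auto simp: en_convergent_def)
    have "(\<lambda>n. 2 * inverse (real (Suc n)) * B\<^sup>2) \<longlonglongrightarrow> 2 * 0 * B\<^sup>2"
      by (intro tendsto_intros LIMSEQ_inverse_real_of_nat)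
    then have lim: "(\<lambda>n. 2 * inverse (real (Suc n)) * B\<^sup>2) \<longlonglongrightarrow> 0"
      by (simp only: mult_zero_right mult_zero_left)
    have le: "norm ((T (s n) \<bullet> t n - h (t n))\<^sup>2) \<le> 2 * inverse (real (Suc n)) * B\<^sup>2" for n
    proof -
      have "2 * (J (s n) - m) * (en (t n))\<^sup>2 \<le> 2 * inverse (real (Suc n)) * B\<^sup>2"
        using s(2)[of n] m[OF s(1)[of n]] B(2)[of n] en_nonneg[OF D]
        by (intro mult_mono power_mono) auto
      then show ?thesis using var[OF s(1)[of n] D[of n]] by simp
    qed
    have "(\<lambda>n. (T (s n) \<bullet> t n - h (t n))\<^sup>2) \<longlonglongrightarrow> 0"
      by (rule Lim_null_comparison[OF always_eventually lim]) (use le in blast)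
    then show ?thesis by (rule power_tendsto_0_iff[THEN iffD1, rotated]) simp
  qed
  ultimately show ?thesis using that by blast
qed

end

section \<open>Riesz representation and Hilbert space adjoints\<close>

text \<open>The coercive form is the inner product itself; constant test sequences turn the
  asymptotic Euler equation into an identity.\<close>

lemma Riesz_representation:
  fixes h :: "'a::{real_inner,complete_space} \<Rightarrow> real"
  assumes "bounded_linear h"
  obtains z where "\<And>v. h v = z \<bullet> v"
proof -
  interpret coercive_operator UNIV "\<lambda>v::'a. v" 1
    by unfold_locales (simp_all add: linear_on_subspace_def power2_norm_eq_inner)
  obtain K where K: "\<And>v. \<bar>h v\<bar> \<le> K * norm v"
    using bounded_linear.bounded[OF assms] by (auto simp: mult.commute)
  have "linear_on_subspace UNIV h"
    using bounded_linear.linear[OF assms] by (simp add: linear_on_subspace_def linear_add linear_scale)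
  then obtain s u where s: "en_convergent s u"
    "\<And>t v. en_convergent t v \<Longrightarrow> (\<lambda>n. s n \<bullet> t n - h (t n)) \<longlonglongrightarrow> 0"
    using Riesz_sequence K by blast
  have "h v = u \<bullet> v" for v
  proof -
    have "(\<lambda>n. s n \<bullet> v - h v) \<longlonglongrightarrow> 0" by (rule s(2)[OF en_convergent_const]) simp
    moreover have "(\<lambda>n. s n \<bullet> v - h v) \<longlonglongrightarrow> u \<bullet> v - h v"
      using s(1) by (intro tendsto_intros) (auto simp: en_convergent_def)
    ultimately show ?thesis using LIMSEQ_unique by fastforce
  qed
  then show ?thesis using that by blast
qed

text \<open>\<open>adjoint\<close> is defined by choice, so the identity can be used only after the
  Riesz representation has supplied some adjoint.\<close>

lemma inner_adjoint:
  fixes f :: "'a::{real_inner,complete_space} \<Rightarrow> 'b::real_inner"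
  assumes "bounded_linear f"
  shows "f x \<bullet> y = x \<bullet> adjoint f y"
proof -
  have "\<exists>z. \<forall>x. f x \<bullet> y = x \<bullet> z" for y
  proof -
    have "bounded_linear (\<lambda>x. f x \<bullet> y)"
      using bounded_linear_compose[OF bounded_linear_inner_left assms] .
    from Riesz_representation[OF this] show ?thesis by (metis inner_commute)
  qed
  then obtain g where "\<forall>x y. f x \<bullet> y = x \<bullet> g y" by metis
  then show ?thesis unfolding adjoint_def by (rule someI2[where P="\<lambda>f'. \<forall>x y. f x \<bullet> y = x \<bullet> f' y"]) blast
qed

lemma bounded_linear_adjoint:
  fixes f :: "'a::{real_inner,complete_space} \<Rightarrow> 'b::real_inner"
  assumes "bounded_linear f"
  shows "bounded_linear (adjoint f)"
proof -
  obtain K where K: "\<And>x. norm (f x) \<le> norm x * K" "0 < K"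
    using bounded_linear.pos_bounded[OF assms] by blast
  note adj = inner_adjoint[OF assms]
  show ?thesis
  proof (rule bounded_linear_intro[where K=K])
    show "adjoint f (x + y) = adjoint f x + adjoint f y" for x y
      by (rule vector_eq_ldot[THEN iffD1]) (simp add: inner_add adj[symmetric])
    show "adjoint f (r *\<^sub>R x) = r *\<^sub>R adjoint f x" for r x
      by (rule vector_eq_ldot[THEN iffD1]) (simp add: adj[symmetric])
    show "norm (adjoint f y) \<le> norm y * K" for y
    proof -
      have "norm (adjoint f y) * norm (adjoint f y) = f (adjoint f y) \<bullet> y"
        by (simp add: adj norm_eq_sqrt_inner)
      also have "\<dots> \<le> norm (f (adjoint f y)) * norm y" by (rule norm_cauchy_schwarz)
      also have "\<dots> \<le> norm (adjoint f y) * K * norm y" by (intro mult_right_mono K) auto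
      finally have "norm (adjoint f y) * norm (adjoint f y) \<le> norm (adjoint f y) * (norm y * K)"
        by (simp add: mult_ac)
      then show ?thesis using K(2) by (cases "adjoint f y = 0") auto
    qed
  qed
qed

text \<open>Uniform boundedness: every \<open>z\<close> is some \<open>f x\<close>, so
  \<open>\<bar>y \<bullet> z\<bar> = \<bar>x \<bullet> g y\<bar> \<le> norm x\<close> for all
  \<open>y\<close> with \<open>norm (g y) \<le> 1\<close>. The set of these \<open>y\<close> is
  therefore weakly bounded, hence bounded by Baire's theorem, and homogeneity turns this into a
  lower bound for \<open>g\<close>.\<close>

lemma bounded_below_of_surj_adjoint:
  fixes f :: "'a::real_inner \<Rightarrow> 'b::{real_inner,complete_space}" and g :: "'b \<Rightarrow> 'a"
  assumes "surj f" and g: "linear g" and adj: "\<And>x y. f x \<bullet> y = x \<bullet> g y"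
  obtains c where "0 < c" "\<And>y. c * norm y \<le> norm (g y)"
proof -
  \<comment> \<open>\<open>F k\<close> collects the \<open>z\<close> against which that set is
    bounded by \<open>k\<close>; surjectivity makes the \<open>F k\<close> exhaust the
    space.\<close>
  define F where "F k = {z. \<forall>y. norm (g y) \<le> 1 \<longrightarrow> \<bar>y \<bullet> z\<bar> \<le> real k}" for k :: nat
  have F: "closed (F k)" for k
  proof -
    have "F k = (\<Inter>y\<in>{y. norm (g y) \<le> 1}. {z. \<bar>y \<bullet> z\<bar> \<le> real k})" by (auto simp: F_def)
    then show ?thesis by (auto intro!: closed_INT closed_Collect_le continuous_intros)
  qed
  have "z \<in> (\<Union>k. F k)" for z
  proof -
    obtain x where x: "z = f x" using \<open>surj f\<close> by (metis surjD)
    obtain k :: nat where k: "norm x \<le> real k" using real_arch_simple by blast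
    have "\<bar>y \<bullet> z\<bar> \<le> real k" if "norm (g y) \<le> 1" for y
    proof -
      have "\<bar>y \<bullet> z\<bar> = \<bar>x \<bullet> g y\<bar>" by (simp add: x inner_commute[of y] adj)
      also have "\<dots> \<le> norm x * norm (g y)" by (rule Cauchy_Schwarz_ineq2)
      also have "\<dots> \<le> norm x * 1" using that by (intro mult_left_mono) auto
      finally show ?thesis using k by simp
    qed
    then show ?thesis by (auto simp: F_def)
  qed
  then have UN: "\<Union>(range F) = UNIV" by auto
  have "\<exists>k. interior (F k) \<noteq> {}"
  proof (rule ccontr)
    assume "\<not> ?thesis"
    then have "euclidean interior_of \<Union>(range F) = {}"
      using F by (intro Baire_category_alt) (auto simp: completely_metrizable_space_euclidean)
    then show False by (simp add: UN)
  qed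
  then obtain k z r where r: "0 < r" "ball z r \<subseteq> F k"
    by (metis all_not_in_conv mem_interior)
  \<comment> \<open>\<open>z\<close> and \<open>z + w\<close> in \<open>F k\<close> give
    \<open>y \<bullet> w \<le> 2 * real k\<close>, while \<open>w\<close> of length
    \<open>r / 2\<close> along \<open>y\<close> gives
    \<open>y \<bullet> w = r * norm y / 2\<close>.\<close>
  define C where "C = 4 * real k / r"
  have bound: "norm y \<le> C" if y: "norm (g y) \<le> 1" for y
  proof (cases "y = 0")
    case False
    define w where "w = (r / (2 * norm y)) *\<^sub>R y"
    have "norm w = r / 2" using False r by (simp add: w_def)
    then have "z + w \<in> F k" "z \<in> F k" using r by (auto intro!: subsetD[OF r(2)] simp: dist_norm)
    then have "\<bar>y \<bullet> (z + w)\<bar> \<le> real k" "\<bar>y \<bullet> z\<bar> \<le> real k" using y by (auto simp: F_def)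
    then have "y \<bullet> w \<le> 2 * real k" by (simp add: inner_add_right)
    moreover have "y \<bullet> w = r * norm y / 2" 
      using False by (simp add: w_def dot_square_norm power2_eq_square)
    ultimately show ?thesis using r by (simp add: C_def field_simps)
  qed (use r in \<open>simp add: C_def\<close>)
  \<comment> \<open>\<open>C + 1\<close> is positive even if \<open>C\<close> is 0. Where
    \<open>g y\<close> vanishes, all multiples of \<open>y\<close> satisfy \<open>bound\<close>,
    which forces \<open>y = 0\<close>.\<close>
  have "norm y \<le> (C + 1) * norm (g y)" for y
  proof (cases "g y = 0")
    case True
    show ?thesis
    proof (rule ccontr)
      assume "\<not> ?thesis"
      then have "0 < norm y" using True by simp
      moreover obtain n :: nat where "C / norm y < real n" using reals_Archimedean2 by blast
      moreover have "norm (real n *\<^sub>R y) \<le> C" using True by (intro bound) (simp add: linear_scale[OF g])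
      ultimately show False by (simp add: field_simps)
    qed
  next
    case False
    have "norm ((1 / norm (g y)) *\<^sub>R y) \<le> C" using False by (intro bound) (simp add: linear_scale[OF g])
    then have "norm y \<le> C * norm (g y)" using False by (simp add: field_simps)
    then show ?thesis by (simp add: distrib_right add_increasing2)
  qed
  moreover have "0 < C + 1" using bound[of 0] by (simp add: linear_0[OF g])
  ultimately show ?thesis
    by (intro that[of "1 / (C + 1)"]) (auto simp: field_simps)
qed

subsection \<open>Maximal monotone relations\<close>

text \<open>Maximality can be tested by adjoining one pair at a time; in this form it yields
  membership of concrete pairs.\<close>

lemma maximal_monotone_relation_iff:
  "maximal_monotone_relation \<Theta> \<longleftrightarrow> monotone_relation \<Theta> \<and>
     (\<forall>x x'. (\<forall>(a, a')\<in>\<Theta>. (x' - a') \<bullet> (x - a) \<ge> 0) \<longrightarrow> (x, x') \<in> \<Theta>)" (is "?L \<longleftrightarrow> ?R")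
proof
  assume L: ?L
  have "(x, x') \<in> \<Theta>" if x: "\<forall>(a, a')\<in>\<Theta>. (x' - a') \<bullet> (x - a) \<ge> 0" for x x'
  proof -
    have "(a' - x') \<bullet> (a - x) \<ge> 0" if "(a, a') \<in> \<Theta>" for a a'
    proof -
      have "(x' - a') \<bullet> (x - a) \<ge> 0" using x that by blast
      then show ?thesis by (simp add: inner_diff_left inner_diff_right)
    qed
    then have "monotone_relation (insert (x, x') \<Theta>)"
      using L x unfolding maximal_monotone_relation_def monotone_relation_def by auto
    then show ?thesis using L unfolding maximal_monotone_relation_def by blast
  qed
  then show ?R using L unfolding maximal_monotone_relation_def by blast
next
  assume R: ?R
  have "\<Phi> \<subseteq> \<Theta>" if "monotone_relation \<Phi>" "\<Theta> \<subset> \<Phi>" for \<Phi>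
  proof
    fix p assume "p \<in> \<Phi>"
    obtain x x' where p: "p = (x, x')" by fastforce
    have "(x' - a') \<bullet> (x - a) \<ge> 0" if "(a, a') \<in> \<Theta>" for a a'
    proof -
      have "(a, a') \<in> \<Phi>" "(x, x') \<in> \<Phi>" using that \<open>\<Theta> \<subset> \<Phi>\<close> \<open>p \<in> \<Phi>\<close> p by auto
      then show ?thesis using \<open>monotone_relation \<Phi>\<close> unfolding monotone_relation_def by blast
    qed
    then show "p \<in> \<Theta>" using R p by blast
  qed
  then show ?L using R unfolding maximal_monotone_relation_def by blast
qed

lemma monotone_relationD:
  "monotone_relation \<Theta> \<Longrightarrow> (x, x') \<in> \<Theta> \<Longrightarrow> (z, z') \<in> \<Theta> \<Longrightarrow> (x' - z') \<bullet> (x - z) \<ge> 0"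
  unfolding monotone_relation_def by blast

section \<open>Minty's theorem\<close>

text \<open>Division by \<open>s\<close> and passage to the limit 0. This is the first-order
  condition at a minimiser over a convex set, where only \<open>s\<close> between 0 and 1 is
  admissible.\<close>

lemma nonneg_of_quadratic_nonneg_near_0:
  fixes A B :: real
  assumes "\<And>s. 0 < s \<Longrightarrow> s \<le> 1 \<Longrightarrow> 0 \<le> s * A + s\<^sup>2 * B"
  shows "0 \<le> A"
proof (rule tendsto_lowerbound)
  have "((\<lambda>s. A + s * B) \<longlongrightarrow> A + 0 * B) (at_right 0)" by (intro tendsto_intros)
  then show "((\<lambda>s. A + s * B) \<longlongrightarrow> A) (at_right 0)" by simp
  have "0 \<le> A + s * B" if "0 < s" "s < 1" for s
  proof -
    have "0 \<le> s * (A + s * B)" using assms[of s] that by (simp add: power2_eq_square algebra_simps)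
    then show ?thesis using that by (simp add: zero_le_mult_iff)
  qed
  then show "\<forall>\<^sub>F s in at_right 0. 0 \<le> A + s * B"
    unfolding eventually_at_right_field by (intro exI[of _ 1]) auto
qed simp

text \<open>
  Following Simons and Zalinescu: \<open>E\<close> below is the epigraph of the Fitzpatrick function of \<open>\<Theta>\<close>, and
  the minimiser of that function plus half the squared norm turns out to be the point sought.
\<close>

lemma maximal_monotone_opposite_pair:
  fixes \<Theta> :: "('b::{real_inner,complete_space} \<times> 'b) set"
  assumes "maximal_monotone_relation \<Theta>"
  obtains x where "(x, - x) \<in> \<Theta>"
proof -
  have mono: "monotone_relation \<Theta>"
    and maxi: "\<And>x x'. (\<And>a a'. (a, a') \<in> \<Theta> \<Longrightarrow> (x' - a') \<bullet> (x - a) \<ge> 0) \<Longrightarrow> (x, x') \<in> \<Theta>"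
    using assms unfolding maximal_monotone_relation_iff by blast+
  \<comment> \<open>The epigraph avoids the supremum over \<Theta>, which may be infinite;
    \<open>t\<close> is the value coordinate.\<close>
  define E where "E = {(x, x', t). \<forall>a a'. (a, a') \<in> \<Theta> \<longrightarrow> x \<bullet> a' + a \<bullet> x' - a \<bullet> a' \<le> (t::real)}"
  define h where "h = (\<lambda>(x::'b, x'::'b, t). t + (x \<bullet> x + x' \<bullet> x') / 2)"
  \<comment> \<open>Monotonicity: on the graph the Fitzpatrick function is at most
    \<open>a \<bullet> a'\<close>.\<close>
  have E_graph: "(a, a', a \<bullet> a') \<in> E" if "(a, a') \<in> \<Theta>" for a a'
  proof -
    have "a \<bullet> b' + b \<bullet> a' - b \<bullet> b' \<le> a \<bullet> a'" if "(b, b') \<in> \<Theta>" for b b'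
      using monotone_relationD[OF mono \<open>(a, a') \<in> \<Theta>\<close> that] by (simp add: inner_diff inner_commute)
    then show ?thesis by (simp add: E_def)
  qed
  \<comment> \<open>Maximality: the Fitzpatrick function is everywhere at least
    \<open>x \<bullet> x'\<close>. Off the graph some \<open>(a, a')\<close> violates monotonicity,
    and its constraint already exceeds \<open>x \<bullet> x'\<close>.\<close>
  have E_ge: "x \<bullet> x' \<le> t" if "(x, x', t) \<in> E" for x x' t
  proof (cases "(x, x') \<in> \<Theta>")
    case True
    have "\<forall>a a'. (a, a') \<in> \<Theta> \<longrightarrow> x \<bullet> a' + a \<bullet> x' - a \<bullet> a' \<le> t" using that by (simp add: E_def)
    with True have "x \<bullet> x' + x \<bullet> x' - x \<bullet> x' \<le> t" by blast
    then show ?thesis by simp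
  next
    case False
    then obtain a a' where a: "(a, a') \<in> \<Theta>" "(x' - a') \<bullet> (x - a) < 0" using maxi[of x' x] by force
    then have "x \<bullet> a' + a \<bullet> x' - a \<bullet> a' \<le> t" using that by (simp add: E_def)
    then show ?thesis using a(2) by (simp add: inner_diff inner_commute)
  qed
  have E_convex: "(x + s *\<^sub>R (y - x), x' + s *\<^sub>R (y' - x'), t + s * (r - t)) \<in> E"
    if "(x, x', t) \<in> E" "(y, y', r) \<in> E" "0 \<le> s" "s \<le> 1" for x x' t y y' r s
  proof -
    have "(x + s *\<^sub>R (y - x)) \<bullet> a' + a \<bullet> (x' + s *\<^sub>R (y' - x')) - a \<bullet> a' \<le> t + s * (r - t)"
      if a: "(a, a') \<in> \<Theta>" for a a'
    proof -
      have "(x + s *\<^sub>R (y - x)) \<bullet> a' + a \<bullet> (x' + s *\<^sub>R (y' - x')) - a \<bullet> a' =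
        (1 - s) * (x \<bullet> a' + a \<bullet> x' - a \<bullet> a') + s * (y \<bullet> a' + a \<bullet> y' - a \<bullet> a')"
        by (simp add: inner_add inner_diff algebra_simps)
      also have "\<dots> \<le> (1 - s) * t + s * r"
        using \<open>(x, x', t) \<in> E\<close> \<open>(y, y', r) \<in> E\<close> \<open>0 \<le> s\<close> \<open>s \<le> 1\<close> a
        by (intro add_mono mult_left_mono) (auto simp: E_def)
      finally show ?thesis by (simp add: algebra_simps)
    qed
    then show ?thesis by (simp add: E_def)
  qed
  have sum_sq: "(x + x') \<bullet> (x + x') = x \<bullet> x + 2 * (x \<bullet> x') + x' \<bullet> x'" for x x' :: 'b
    by (simp add: inner_add inner_commute)
  \<comment> \<open>\<open>E_ge\<close> bounds \<open>h\<close> below by half the squared norm of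
    \<open>x + x'\<close>.\<close>
  have h_nonneg: "0 \<le> h p" if "p \<in> E" for p
  proof -
    obtain x x' t where p: "p = (x, x', t)" by (cases p)
    then have "x \<bullet> x' \<le> t" using that E_ge by simp
    then show ?thesis using inner_ge_zero[of "x + x'"] sum_sq[of x x'] unfolding h_def p prod.case by argo
  qed
  have "E \<noteq> {}"
  proof -
    have "\<exists>p. p \<in> \<Theta>"
    proof (rule ccontr)
      assume "\<nexists>p. p \<in> \<Theta>"
      then show False using maxi[of 0 0] by auto
    qed
    then show ?thesis using E_graph by fastforce
  qed
  define m where "m = Inf (h ` E)"
  have bdd: "bdd_below (h ` E)" using h_nonneg by (auto intro!: bdd_belowI)
  have m: "m \<le> h p" if "p \<in> E" for p
    unfolding m_def using that bdd by (intro cInf_lower) auto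
  have "\<exists>p. p \<in> E \<and> h p < m + inverse (real (Suc n))" for n
  proof -
    have "h ` E \<noteq> {}" "Inf (h ` E) < m + inverse (real (Suc n))" using \<open>E \<noteq> {}\<close> by (auto simp: m_def)
    from cInf_lessD[OF this] show ?thesis by blast
  qed
  then obtain p where "\<forall>n. p n \<in> E \<and> h (p n) < m + inverse (real (Suc n))"
    using choice[of "\<lambda>n p. p \<in> E \<and> h p < m + inverse (real (Suc n))"] by blast
  then have p: "\<And>n. p n \<in> E" "\<And>n. h (p n) < m + inverse (real (Suc n))" by auto
  define X X' R where "X n = fst (p n)" and "X' n = fst (snd (p n))" and "R n = snd (snd (p n))" for n
  have p_eq: "p n = (X n, X' n, R n)" for n by (simp add: X_def X'_def R_def)
  have EX: "(X n, X' n, R n) \<in> E" for n using p(1)[of n] by (simp add: p_eq)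
  have hX: "R n + (X n \<bullet> X n + X' n \<bullet> X' n) / 2 < m + inverse (real (Suc n))" for n
    using p(2)[of n] by (simp add: p_eq h_def)
  \<comment> \<open>The midpoint lies in the convex set \<open>E\<close>, and \<open>h\<close> is
    affine in \<open>t\<close>, so only the midpoint defect of the squared norms remains.\<close>
  have par: "(norm (X n - X k))\<^sup>2 + (norm (X' n - X' k))\<^sup>2 \<le> 
    4 * (inverse (real (Suc n)) + inverse (real (Suc k)))" for n k
  proof -
    have "m \<le> h (X n + (1/2) *\<^sub>R (X k - X n), X' n + (1/2) *\<^sub>R (X' k - X' n), R n + (1/2) * (R k - R n))"
      by (intro m E_convex EX) auto
    moreover have mid: "(x + (1/2) *\<^sub>R (y - x)) \<bullet> (x + (1/2) *\<^sub>R (y - x)) 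
        = (x \<bullet> x + y \<bullet> y) / 2 - (norm (x - y))\<^sup>2 / 4" for x y :: 'b
      by (simp add: power2_norm_eq_inner inner_add inner_diff inner_commute field_simps)
    ultimately show ?thesis using hX[of n] hX[of k]
      unfolding h_def prod.case mid by argo
  qed
  have small: "\<exists>N. \<forall>n\<ge>N. inverse (real (Suc n)) < e" if "e > 0" for e
    using LIMSEQ_D[OF LIMSEQ_inverse_real_of_nat that] by auto
  have Cauchy_of_par: "Cauchy Y"
    if Y: "\<And>n k. (norm (Y n - Y k))\<^sup>2 \<le> 4 * (inverse (real (Suc n)) + inverse (real (Suc k)))" 
    for Y :: "nat \<Rightarrow> 'b"
  proof (rule metric_CauchyI)
    fix e :: real assume "e > 0"
    then obtain N where N: "\<And>n. n \<ge> N \<Longrightarrow> inverse (real (Suc n)) < e\<^sup>2 / 8"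
      using small[of "e\<^sup>2 / 8"] by auto
    have "dist (Y n) (Y k) < e" if "n \<ge> N" "k \<ge> N" for n k
    proof (rule power2_less_imp_less)
      show "(dist (Y n) (Y k))\<^sup>2 < e\<^sup>2"
        using Y[of n k] N[OF that(1)] N[OF that(2)] unfolding dist_norm by argo
    qed (use \<open>e > 0\<close> in simp)
    then show "\<exists>M. \<forall>n\<ge>M. \<forall>k\<ge>M. dist (Y n) (Y k) < e" by blast
  qed
  have "Cauchy X" "Cauchy X'"
    by (rule Cauchy_of_par, rule order_trans[OF _ par], simp)+
  then obtain x0 x0' where x0: "X \<longlonglongrightarrow> x0" "X' \<longlonglongrightarrow> x0'"
    using Cauchy_convergent convergent_def by blast
  \<comment> \<open>Chosen so that the limit point has \<open>h\<close>-value \<open>m\<close>. Only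
    an upper bound of \<open>R\<close> is known to converge, namely to \<open>t0\<close>; this
    suffices, since the constraints of \<open>E\<close> bound \<open>t\<close> from below.\<close>
  define t0 where "t0 = m - (x0 \<bullet> x0 + x0' \<bullet> x0') / 2"
  have R_le: "R n \<le> m + inverse (real (Suc n)) - (X n \<bullet> X n + X' n \<bullet> X' n) / 2" for n
    using hX[of n] by linarith
  have lim: "(\<lambda>n. m + inverse (real (Suc n)) - (X n \<bullet> X n + X' n \<bullet> X' n) / 2) \<longlonglongrightarrow> 
      m + 0 - (x0 \<bullet> x0 + x0' \<bullet> x0') / 2"
    by (intro tendsto_intros LIMSEQ_inverse_real_of_nat x0) simp
  have E0: "(x0, x0', t0) \<in> E"
  proof -
    have "x0 \<bullet> a' + a \<bullet> x0' - a \<bullet> a' \<le> t0" if a: "(a, a') \<in> \<Theta>" for a a'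
    proof -
      have "x0 \<bullet> a' + a \<bullet> x0' - a \<bullet> a' \<le> m + 0 - (x0 \<bullet> x0 + x0' \<bullet> x0') / 2"
      proof (rule LIMSEQ_le[OF _ lim])
        show "(\<lambda>n. X n \<bullet> a' + a \<bullet> X' n - a \<bullet> a') \<longlonglongrightarrow> x0 \<bullet> a' + a \<bullet> x0' - a \<bullet> a'"
          by (intro tendsto_intros x0)
        have "X n \<bullet> a' + a \<bullet> X' n - a \<bullet> a' \<le> m + inverse (real (Suc n)) - (X n \<bullet> X n + X' n \<bullet> X' n) / 2" for n
          using R_le[of n] EX[of n] a by (force simp: E_def)
        then show "\<exists>N. \<forall>n\<ge>N. X n \<bullet> a' + a \<bullet> X' n - a \<bullet> a' \<le> 
           m + inverse (real (Suc n)) - (X n \<bullet> X n + X' n \<bullet> X' n) / 2" by blast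
      qed
      then show ?thesis by (simp add: t0_def)
    qed
    then show ?thesis by (simp add: E_def)
  qed
  \<comment> \<open>First-order condition at the minimiser in the direction of
    \<open>(a, a', a \<bullet> a')\<close>; the inequality \<open>E_ge\<close> at the minimiser
    completes the square on the left.\<close>
  have key: "(x0 + x0') \<bullet> (x0 + x0') \<le> (- x0 - a') \<bullet> (- x0' - a)" if a: "(a, a') \<in> \<Theta>" for a a'
  proof -
    have "0 \<le> (a \<bullet> a' - t0) + x0 \<bullet> (a - x0) + x0' \<bullet> (a' - x0')"
    proof (rule nonneg_of_quadratic_nonneg_near_0)
      fix s :: real assume s: "0 < s" "s \<le> 1"
      have "m \<le> h (x0 + s *\<^sub>R (a - x0), x0' + s *\<^sub>R (a' - x0'), t0 + s * (a \<bullet> a' - t0))"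
        using s by (intro m E_convex E0 E_graph a) auto
      moreover have sq: "(x + s *\<^sub>R d) \<bullet> (x + s *\<^sub>R d) = x \<bullet> x + 2 * (s * (x \<bullet> d)) + s\<^sup>2 * (d \<bullet> d)" for x d :: 'b
        by (simp add: inner_add inner_commute power2_eq_square)
      ultimately show "0 \<le> s * ((a \<bullet> a' - t0) + x0 \<bullet> (a - x0) + x0' \<bullet> (a' - x0')) 
         + s\<^sup>2 * (((a - x0) \<bullet> (a - x0) + (a' - x0') \<bullet> (a' - x0')) / 2)"
        unfolding h_def prod.case sq t0_def by argo
    qed
    then have "0 \<le> a \<bullet> a' - t0 + x0 \<bullet> a - x0 \<bullet> x0 + x0' \<bullet> a' - x0' \<bullet> x0'" by (simp add: inner_diff_right)
    moreover have "(- x0 - a') \<bullet> (- x0' - a) = x0 \<bullet> x0' + x0 \<bullet> a + x0' \<bullet> a' + a \<bullet> a'"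
      by (simp add: inner_diff inner_commute)
    ultimately show ?thesis using E_ge[OF E0] sum_sq[of x0 x0'] by linarith
  qed
  \<comment> \<open>By \<open>key\<close>, the pair \<open>(- x0', - x0)\<close> is monotonically
    related to all of \<Theta>. Inserted into \<open>key\<close> itself, it makes the right side
    vanish, so \<open>x0' = - x0\<close>.\<close>
  have mem: "(- x0', - x0) \<in> \<Theta>"
    using key inner_ge_zero[of "x0 + x0'"] by (intro maxi) (metis order_trans)
  from key[OF this] have "(x0 + x0') \<bullet> (x0 + x0') \<le> 0" by simp
  then have "x0 + x0' = 0" by (metis inner_ge_zero inner_eq_zero_iff order_antisym)
  then have "x0' = - x0" by (simp add: eq_neg_iff_add_eq_0 add.commute)
  then show ?thesis using mem that by simp
qed

text \<open>Rescaling the values by \<rho> and shifting them by \<open>- y\<close> keeps the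
  relation maximal monotone, and a pair \<open>(x, - x)\<close> of the result is exactly a
  solution.\<close>

theorem Minty_range:
  fixes \<Theta> :: "('b::{real_inner,complete_space} \<times> 'b) set"
  assumes \<Theta>: "maximal_monotone_relation \<Theta>" and "0 < \<rho>"
  obtains x x' where "(x, x') \<in> \<Theta>" "x + \<rho> *\<^sub>R x' = y"
proof -
  define \<Phi> where "\<Phi> = {(a, \<rho> *\<^sub>R a' - y) | a a'. (a, a') \<in> \<Theta>}"
  have mono: "monotone_relation \<Theta>"
    and maxi: "\<And>x x'. (\<And>a a'. (a, a') \<in> \<Theta> \<Longrightarrow> (x' - a') \<bullet> (x - a) \<ge> 0) \<Longrightarrow> (x, x') \<in> \<Theta>"
    using \<Theta> unfolding maximal_monotone_relation_iff by blast+
  have scale: "(\<rho> *\<^sub>R a' - y - (\<rho> *\<^sub>R b' - y)) \<bullet> d = \<rho> * ((a' - b') \<bullet> d)" for a' b' d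
    by (simp add: inner_diff right_diff_distrib)
  have scale': "(\<rho> *\<^sub>R a' - \<rho> *\<^sub>R b') \<bullet> d = \<rho> * ((a' - b') \<bullet> d)" for a' b' d
    by (simp add: inner_diff right_diff_distrib)
  have "maximal_monotone_relation \<Phi>"
    unfolding maximal_monotone_relation_iff
  proof (intro conjI allI impI)
    show "monotone_relation \<Phi>"
      unfolding monotone_relation_def \<Phi>_def
      using monotone_relationD[OF mono] \<open>0 < \<rho>\<close> by (auto simp: scale')
    fix x x' assume *: "\<forall>(a, a')\<in>\<Phi>. (x' - a') \<bullet> (x - a) \<ge> 0"
    define z where "z = (1 / \<rho>) *\<^sub>R (x' + y)"
    have x': "x' = \<rho> *\<^sub>R z - y" using \<open>0 < \<rho>\<close> by (simp add: z_def)
    have "(x, z) \<in> \<Theta>"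
    proof (rule maxi)
      fix a a' assume "(a, a') \<in> \<Theta>"
      then have "(a, \<rho> *\<^sub>R a' - y) \<in> \<Phi>" by (auto simp: \<Phi>_def)
      then have "0 \<le> \<rho> * ((z - a') \<bullet> (x - a))" using * by (auto simp: x' scale')
      then show "0 \<le> (z - a') \<bullet> (x - a)" using \<open>0 < \<rho>\<close> by (simp add: zero_le_mult_iff)
    qed
    then show "(x, x') \<in> \<Phi>" by (auto simp: \<Phi>_def x')
  qed
  then obtain x where "(x, - x) \<in> \<Phi>" by (rule maximal_monotone_opposite_pair)
  then obtain x' where "(x, x') \<in> \<Theta>" "- x = \<rho> *\<^sub>R x' - y" by (auto simp: \<Phi>_def)
  then show ?thesis using that[of x x'] by (metis add.inverse_inverse add_diff_cancel_left' diff_add_cancel uminus_add_conv_diff)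
qed

text \<open>
  With \<open>J\<close> the nonexpansive map \<open>(1 + \<rho> \<Theta>)\<^sup>-\<^sup>1\<close>, the equation \<open>x' + P x = \<eta>\<close> for \<open>(x, x') \<in> \<Theta>\<close> is the fixed
  point equation \<open>x = J (x - \<rho> (P x - \<eta>))\<close>, and \<open>1 - \<rho> P\<close> is a strict contraction for \<open>\<rho>\<close> small.
\<close>

lemma maximal_monotone_plus_coercive_surj:
  fixes \<Theta> :: "('b::{real_inner,complete_space} \<times> 'b) set" and P :: "'b \<Rightarrow> 'b"
  assumes \<Theta>: "maximal_monotone_relation \<Theta>" and P: "bounded_linear P"
    and "0 < c" and coercive: "\<And>x. c * (norm x)\<^sup>2 \<le> P x \<bullet> x"
  obtains x x' where "(x, x') \<in> \<Theta>" "x' + P x = \<eta>"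
proof -
  have mono: "monotone_relation \<Theta>" using \<Theta> by (simp add: maximal_monotone_relation_def)
  obtain L0 where L0: "0 < L0" "\<And>x. norm (P x) \<le> norm x * L0" using bounded_linear.pos_bounded[OF P] by blast
  \<comment> \<open>Raising the bound of \<open>P\<close> to at least \<open>c\<close> keeps
    \<open>1 - c\<^sup>2 / L\<^sup>2\<close> nonnegative.\<close>
  define L where "L = max L0 c"
  have L: "0 < L" "c \<le> L" using L0 by (auto simp: L_def)
  have P_le: "norm (P x) \<le> L * norm x" for x
    using L0(2)[of x] mult_right_mono[of L0 L "norm x"] by (simp add: L_def mult.commute)
  \<comment> \<open>The minimiser of
    \<open>1 - 2 * (\<rho> * c) + \<rho>\<^sup>2 * L\<^sup>2\<close>; the minimum
    \<open>1 - c\<^sup>2 / L\<^sup>2\<close> is the square of the contraction factor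
    \<open>k\<close>.\<close>
  define \<rho> where "\<rho> = c / L\<^sup>2"
  have "0 < \<rho>" using \<open>0 < c\<close> L by (simp add: \<rho>_def)
  have "\<exists>x. \<exists>x'. (x, x') \<in> \<Theta> \<and> x + \<rho> *\<^sub>R x' = y" for y
    using Minty_range[OF \<Theta> \<open>0 < \<rho>\<close>] by metis
  then obtain J where "\<forall>y. \<exists>x'. (J y, x') \<in> \<Theta> \<and> J y + \<rho> *\<^sub>R x' = y"
    using choice[of "\<lambda>y x. \<exists>x'. (x, x') \<in> \<Theta> \<and> x + \<rho> *\<^sub>R x' = y"] by blast
  then have J: "\<exists>x'. (J y, x') \<in> \<Theta> \<and> J y + \<rho> *\<^sub>R x' = y" for y by blast
  have J_contr: "norm (J y - J z) \<le> norm (y - z)" for y z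
  proof -
    obtain y' z' where yz: "(J y, y') \<in> \<Theta>" "(J z, z') \<in> \<Theta>" 
      "J y + \<rho> *\<^sub>R y' = y" "J z + \<rho> *\<^sub>R z' = z" using J[of y] J[of z] by blast
    have "y - z = (J y - J z) + \<rho> *\<^sub>R (y' - z')"
      using yz(3,4) by (metis (no_types, lifting) add_diff_add scaleR_diff_right)
    then have "(y - z) \<bullet> (J y - J z) = (norm (J y - J z))\<^sup>2 + \<rho> * ((y' - z') \<bullet> (J y - J z))"
      by (simp add: inner_add_left power2_norm_eq_inner)
    moreover have "0 \<le> \<rho> * ((y' - z') \<bullet> (J y - J z))"
      using monotone_relationD[OF mono yz(1,2)] \<open>0 < \<rho>\<close> by simp
    moreover have "(y - z) \<bullet> (J y - J z) \<le> norm (y - z) * norm (J y - J z)" by (rule norm_cauchy_schwarz)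
    ultimately have "norm (J y - J z) * norm (J y - J z) \<le> norm (y - z) * norm (J y - J z)"
      by (simp add: power2_eq_square)
    then show ?thesis by (cases "J y = J z") auto
  qed
  define F where "F x = J (x - \<rho> *\<^sub>R (P x - \<eta>))" for x
  define k where "k = sqrt (1 - c\<^sup>2 / L\<^sup>2)"
  have cL: "c\<^sup>2 / L\<^sup>2 \<le> 1" "0 < c\<^sup>2 / L\<^sup>2" using L \<open>0 < c\<close> by (auto simp: power_mono)
  have F_contr: "dist (F x) (F y) \<le> k * dist x y" for x y
  proof -
    define d where "d = x - y"
    have "x - \<rho> *\<^sub>R (P x - \<eta>) - (y - \<rho> *\<^sub>R (P y - \<eta>)) = d - \<rho> *\<^sub>R P d"
      by (simp add: d_def linear_diff[OF bounded_linear.linear[OF P]] algebra_simps)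
    then have "dist (F x) (F y) \<le> norm (d - \<rho> *\<^sub>R P d)"
      using J_contr[of "x - \<rho> *\<^sub>R (P x - \<eta>)" "y - \<rho> *\<^sub>R (P y - \<eta>)"] by (simp add: F_def dist_norm)
    also have "\<dots> \<le> k * norm d"
    proof (rule power2_le_imp_le)
      have "(norm (d - \<rho> *\<^sub>R P d))\<^sup>2 = (norm d)\<^sup>2 - 2 * \<rho> * (P d \<bullet> d) + \<rho>\<^sup>2 * (norm (P d))\<^sup>2"
        by (simp add: power2_norm_eq_inner inner_diff inner_commute power2_eq_square[of \<rho>])
      also have "\<dots> \<le> (norm d)\<^sup>2 - 2 * \<rho> * (c * (norm d)\<^sup>2) + \<rho>\<^sup>2 * (L * norm d)\<^sup>2"
        using coercive[of d] P_le[of d] \<open>0 < \<rho>\<close>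
        by (intro add_mono diff_mono mult_left_mono power_mono) auto
      also have "\<dots> = (1 - 2 * (\<rho> * c) + \<rho>\<^sup>2 * L\<^sup>2) * (norm d)\<^sup>2"
        by (simp add: algebra_simps power_mult_distrib)
      also have "1 - 2 * (\<rho> * c) + \<rho>\<^sup>2 * L\<^sup>2 = 1 - c\<^sup>2 / L\<^sup>2"
        using L by (simp add: \<rho>_def field_simps power2_eq_square)
      also have "(1 - c\<^sup>2 / L\<^sup>2) * (norm d)\<^sup>2 = (k * norm d)\<^sup>2" using cL by (simp add: k_def power_mult_distrib)
      finally show "(norm (d - \<rho> *\<^sub>R P d))\<^sup>2 \<le> (k * norm d)\<^sup>2" .
    qed (use cL in \<open>simp add: k_def\<close>)
    finally show ?thesis by (simp add: d_def dist_norm)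
  qed
  have "0 \<le> k" "k < 1" using cL by (auto simp: k_def)
  then obtain x where x: "F x = x" using banach_fix_type[of k F] F_contr by blast
  obtain x' where x': "(x, x') \<in> \<Theta>" "x + \<rho> *\<^sub>R x' = x - \<rho> *\<^sub>R (P x - \<eta>)"
    using J[of "x - \<rho> *\<^sub>R (P x - \<eta>)"] x by (auto simp: F_def)
  then have "\<rho> *\<^sub>R (x' + P x - \<eta>) = 0" by (simp add: algebra_simps)
  then have "x' + P x = \<eta>" using \<open>0 < \<rho>\<close> by simp
  with x' show ?thesis using that by blast
qed

section \<open>Sums with bounded positive operators\<close>

lemma monotone_rel_plus:
  assumes "monotone_relation \<Theta>" "linear P" "\<And>x. 0 \<le> P x \<bullet> x"
  shows "monotone_relation (rel_plus \<Theta> P)"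
proof -
  have "0 \<le> (x' + P x - (z' + P z)) \<bullet> (x - z)" if "(x, x') \<in> \<Theta>" "(z, z') \<in> \<Theta>" for x x' z z'
  proof -
    have "(x' + P x - (z' + P z)) \<bullet> (x - z) = (x' - z') \<bullet> (x - z) + P (x - z) \<bullet> (x - z)"
      by (simp add: linear_diff[OF assms(2)] inner_add inner_diff)
    then show ?thesis using monotone_relationD[OF assms(1) that] assms(3)[of "x - z"] by simp
  qed
  then show ?thesis unfolding monotone_relation_def rel_plus_def by blast
qed

text \<open>As \<open>P\<close> plus the identity is coercive, adding it to \<Theta> gives a
  relation that is onto. A pair monotonically related to \<open>rel_plus \<Theta> P\<close> can thus
  be compared with a member having the same sum of components, and the two coincide.\<close>

lemma maximal_monotone_rel_plus:
  fixes \<Theta> :: "('b::{real_inner,complete_space} \<times> 'b) set" and P :: "'b \<Rightarrow> 'b"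
  assumes \<Theta>: "maximal_monotone_relation \<Theta>" and P: "bounded_linear P" and pos: "\<And>x. 0 \<le> P x \<bullet> x"
  shows "maximal_monotone_relation (rel_plus \<Theta> P)"
  unfolding maximal_monotone_relation_iff
proof (intro conjI allI impI)
  show "monotone_relation (rel_plus \<Theta> P)"
    using \<Theta> pos bounded_linear.linear[OF P] 
    by (intro monotone_rel_plus) (auto simp: maximal_monotone_relation_def)
  fix x x' assume *: "\<forall>(a, a')\<in>rel_plus \<Theta> P. (x' - a') \<bullet> (x - a) \<ge> 0"
  have "bounded_linear (\<lambda>x. P x + x)" by (intro bounded_linear_add P bounded_linear_ident)
  moreover have "1 * (norm x)\<^sup>2 \<le> (P x + x) \<bullet> x" for x
    using pos[of x] by (simp add: inner_add_left power2_norm_eq_inner)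
  ultimately obtain z z' where z: "(z, z') \<in> \<Theta>" "z' + (P z + z) = x' + x"
    using maximal_monotone_plus_coercive_surj[OF \<Theta>, of "\<lambda>x. P x + x" 1] by (metis zero_less_one)
  have "(z, z' + P z) \<in> rel_plus \<Theta> P" using z by (auto simp: rel_plus_def)
  then have "0 \<le> (x' - (z' + P z)) \<bullet> (x - z)" using * by blast
  moreover have "x' - (z' + P z) = - (x - z)" using z(2) by (simp add: algebra_simps)
  ultimately have "(x - z) \<bullet> (x - z) \<le> 0" by (simp add: inner_diff_left inner_diff_right)
  then have "x = z" by (metis inner_ge_zero inner_eq_zero_iff order_antisym right_minus_eq)
  then show "(x, x') \<in> rel_plus \<Theta> P" using z by (auto simp: rel_plus_def add.assoc[symmetric])
qed

subsection \<open>The Friedrichs extension\<close>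

lemma eq_0_of_orthogonal_dense:
  fixes w :: "'a::real_inner"
  assumes "closure X = UNIV" "\<And>v. v \<in> X \<Longrightarrow> w \<bullet> v = 0"
  shows "w = 0"
proof -
  have "closed {v. w \<bullet> v = 0}" by (intro closed_Collect_eq continuous_intros)
  then have "closure X \<subseteq> {v. w \<bullet> v = 0}" using assms(2) by (intro closure_minimal) auto
  then have "w \<in> {v. w \<bullet> v = 0}" unfolding assms(1) by blast
  then show ?thesis by simp
qed

lemma rel_app_eq: "single_valued A \<Longrightarrow> (u, w) \<in> A \<Longrightarrow> rel_app A u = w"
  unfolding rel_app_def by (rule the_equality) (auto dest: single_valuedD)

lemma rel_app_mem: "single_valued A \<Longrightarrow> u \<in> Domain A \<Longrightarrow> (u, rel_app A u) \<in> A"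
  using rel_app_eq by fastforce

lemma linear_operator_subspace_Domain:
  assumes "linear_operator A" shows "subspace (Domain A)"
proof -
  have "subspace A" using assms by (simp add: linear_operator_def)
  then show ?thesis
    unfolding subspace_def by (auto simp: zero_prod_def) (metis DomainI add_Pair, metis DomainI scaleR_Pair)
qed

lemma linear_operator_linear_on:
  assumes "linear_operator A" shows "linear_on_subspace (Domain A) (rel_app A)"
proof -
  have A: "subspace A" "single_valued A" using assms by (auto simp: linear_operator_def)
  note mem = rel_app_mem[OF A(2)]
  show ?thesis unfolding linear_on_subspace_def
  proof (intro conjI ballI allI)
    fix u v assume "u \<in> Domain A" "v \<in> Domain A"
    from subspace_add[OF A(1) mem[OF this(1)] mem[OF this(2)]]
    show "rel_app A (u + v) = rel_app A u + rel_app A v" by (intro rel_app_eq A) simp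
  next
    fix u and c :: real assume "u \<in> Domain A"
    from subspace_scale[OF A(1) mem[OF this], of c]
    show "rel_app A (c *\<^sub>R u) = c *\<^sub>R rel_app A u" by (intro rel_app_eq A) simp
  qed
qed

section \<open>The closure of a semibounded form\<close>

locale semibounded_operator =
  fixes S :: "('a::{real_inner,complete_space} \<times> 'a) set" and \<omega> :: real
  assumes linear: "linear_operator S" and dense: "densely_defined S"
    and symmetric: "symmetric_operator S" and bounded: "bounded_below (- \<omega>) S"
begin

abbreviation shifted :: "real \<Rightarrow> 'a \<Rightarrow> 'a" where "shifted l u \<equiv> rel_app S u + l *\<^sub>R u"

lemma single: "single_valued S" using linear by (simp add: linear_operator_def)

lemma coercive: "\<omega> < l \<Longrightarrow> coercive_operator (Domain S) (shifted l) (l - \<omega>)"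
proof
  assume "\<omega> < l"
  show "subspace (Domain S)" by (rule linear_operator_subspace_Domain[OF linear])
  show "linear_on_subspace (Domain S) (shifted l)"
    using linear_operator_linear_on[OF linear] by (simp add: linear_on_subspace_def algebra_simps)
  show "0 < l - \<omega>" using \<open>\<omega> < l\<close> by simp
  note mem = rel_app_mem[OF single]
  show "shifted l u \<bullet> v = u \<bullet> shifted l v" if "u \<in> Domain S" "v \<in> Domain S" for u v
    using symmetric mem[OF that(1)] mem[OF that(2)] unfolding symmetric_operator_def
    by (auto simp: inner_add)
  show "(l - \<omega>) * (norm u)\<^sup>2 \<le> shifted l u \<bullet> u" if "u \<in> Domain S" for u
  proof -
    have "- \<omega> * (norm u)\<^sup>2 \<le> rel_app S u \<bullet> u" using bounded mem[OF that] unfolding bounded_below_def by blast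
    then show ?thesis by (simp add: inner_add_left power2_norm_eq_inner left_diff_distrib)
  qed
qed

text \<open>The squared energy norm of \<open>s m - s n\<close> differs from the form by
  \<open>l\<close> times a squared norm, which vanishes along a convergent sequence. Hence all
  shifts above \<omega> give the same notion, and the results on coercive operators apply to
  it.\<close>

lemma form_convergent_iff:
  assumes "\<omega> < l"
  shows "form_convergent S s u \<longleftrightarrow> coercive_operator.en_convergent (Domain S) (shifted l) s u"
proof -
  interpret coercive_operator "Domain S" "shifted l" "l - \<omega>" by (rule coercive[OF assms])
  let ?q = "\<lambda>m n. rel_app S (s m - s n) \<bullet> (s m - s n)"
  have tends: "((\<lambda>(m, n). ?q m n) \<longlongrightarrow> 0) (sequentially \<times>\<^sub>F sequentially) \<longleftrightarrow>
     (\<forall>e>0. \<exists>N. \<forall>m\<ge>N. \<forall>n\<ge>N. \<bar>?q m n\<bar> < e)"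
    unfolding tendsto_iff eventually_prod_sequentially by (simp add: dist_real_def) blast
  have "(\<forall>e>0. \<exists>N. \<forall>m\<ge>N. \<forall>n\<ge>N. \<bar>?q m n\<bar> < e) \<longleftrightarrow> (\<forall>e>0. \<exists>N. \<forall>m\<ge>N. \<forall>n\<ge>N. en (s m - s n) < e)"
    if s: "range s \<subseteq> Domain S" "s \<longlonglongrightarrow> u"
  proof -
    have D: "s n \<in> Domain S" for n using s by auto
    have en: "(en (s m - s n))\<^sup>2 = ?q m n + l * (norm (s m - s n))\<^sup>2" for m n
      by (simp add: en_square D D_diff inner_add_left power2_norm_eq_inner)
    have "Cauchy s" using s(2) by (rule LIMSEQ_imp_Cauchy)
    have small: "\<exists>N. \<forall>m\<ge>N. \<forall>n\<ge>N. \<bar>l * (norm (s m - s n))\<^sup>2\<bar> < e" if "0 < e" for e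
    proof -
      \<comment> \<open>\<open>\<bar>l\<bar> + 1\<close> allows for \<open>l\<close> of either sign
        and for 0.\<close>
      have "0 < sqrt (e / (\<bar>l\<bar> + 1))" using that by simp
      then obtain N where N: "\<And>m n. m \<ge> N \<Longrightarrow> n \<ge> N \<Longrightarrow> norm (s m - s n) < sqrt (e / (\<bar>l\<bar> + 1))"
        using \<open>Cauchy s\<close> unfolding Cauchy_def dist_norm by meson
      have "\<bar>l * (norm (s m - s n))\<^sup>2\<bar> < e" if "m \<ge> N" "n \<ge> N" for m n
      proof -
        have "(norm (s m - s n))\<^sup>2 < (sqrt (e / (\<bar>l\<bar> + 1)))\<^sup>2"
          using N[OF that] by (intro power_strict_mono) auto
        then have "(\<bar>l\<bar> + 1) * (norm (s m - s n))\<^sup>2 < e" using \<open>0 < e\<close> by (simp add: field_simps)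
        moreover have "\<bar>l * (norm (s m - s n))\<^sup>2\<bar> \<le> (\<bar>l\<bar> + 1) * (norm (s m - s n))\<^sup>2"
          by (simp add: abs_mult distrib_right)
        ultimately show ?thesis by linarith
      qed
      then show ?thesis by blast
    qed
    show ?thesis
    proof (intro iffI allI impI)
      fix e :: real
      assume q: "\<forall>e>0. \<exists>N. \<forall>m\<ge>N. \<forall>n\<ge>N. \<bar>?q m n\<bar> < e" and "0 < e"
      then have e: "0 < e\<^sup>2 / 2" by simp
      obtain N1 where N1: "\<And>m n. m \<ge> N1 \<Longrightarrow> n \<ge> N1 \<Longrightarrow> \<bar>?q m n\<bar> < e\<^sup>2 / 2" using q e by meson
      obtain N2 where N2: "\<And>m n. m \<ge> N2 \<Longrightarrow> n \<ge> N2 \<Longrightarrow> \<bar>l * (norm (s m - s n))\<^sup>2\<bar> < e\<^sup>2 / 2"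
        using small[OF e] by meson
      have "en (s m - s n) < e" if "m \<ge> max N1 N2" "n \<ge> max N1 N2" for m n
      proof (rule power2_less_imp_less)
        show "(en (s m - s n))\<^sup>2 < e\<^sup>2" using en[of m n] N1[of m n] N2[of m n] that by simp
      qed (use \<open>0 < e\<close> in simp)
      then show "\<exists>N. \<forall>m\<ge>N. \<forall>n\<ge>N. en (s m - s n) < e" by blast
    next
      fix e :: real
      assume q: "\<forall>e>0. \<exists>N. \<forall>m\<ge>N. \<forall>n\<ge>N. en (s m - s n) < e" and "0 < e"
      then have e: "0 < sqrt (e / 2)" "0 < e / 2" by simp_all
      obtain N1 where N1: "\<And>m n. m \<ge> N1 \<Longrightarrow> n \<ge> N1 \<Longrightarrow> en (s m - s n) < sqrt (e / 2)" using q e by meson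
      obtain N2 where N2: "\<And>m n. m \<ge> N2 \<Longrightarrow> n \<ge> N2 \<Longrightarrow> \<bar>l * (norm (s m - s n))\<^sup>2\<bar> < e / 2"
        using small[OF e(2)] by meson
      have "\<bar>?q m n\<bar> < e" if "m \<ge> max N1 N2" "n \<ge> max N1 N2" for m n
      proof -
        have "(en (s m - s n))\<^sup>2 < (sqrt (e / 2))\<^sup>2"
          using N1[of m n] that by (intro power_strict_mono en_nonneg D D_diff) auto
        then have "(en (s m - s n))\<^sup>2 < e / 2" using \<open>0 < e\<close> by simp
        then show ?thesis using en[of m n] N2[of m n] that zero_le_power2[of "en (s m - s n)"] by simp
      qed
      then show "\<exists>N. \<forall>m\<ge>N. \<forall>n\<ge>N. \<bar>?q m n\<bar> < e" by blast
    qed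
  qed
  then show ?thesis unfolding form_convergent_def en_convergent_def tends by blast
qed

text \<open>A reference shift; by \<open>form_convergent_iff\<close> its value above \<omega> is
  immaterial for convergence.\<close>

interpretation F: coercive_operator "Domain S" "shifted (\<omega> + 1)" "(\<omega> + 1) - \<omega>"
  by (rule coercive) simp

lemma form_convergent_eq: "form_convergent S s u \<longleftrightarrow> F.en_convergent s u"
  by (rule form_convergent_iff) simp

lemma form_convergent_add:
  "form_convergent S s u \<Longrightarrow> form_convergent S t v \<Longrightarrow> form_convergent S (\<lambda>n. s n + t n) (u + v)"
  and form_convergent_scale: "form_convergent S s u \<Longrightarrow> form_convergent S (\<lambda>n. r *\<^sub>R s n) (r *\<^sub>R u)"
  and form_convergent_const: "u \<in> Domain S \<Longrightarrow> form_convergent S (\<lambda>_. u) u"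
  unfolding form_convergent_eq
  by (fact F.en_convergent_add F.en_convergent_scale F.en_convergent_const)+

lemma form_convergentD:
  "form_convergent S s u \<Longrightarrow> s n \<in> Domain S" "form_convergent S s u \<Longrightarrow> s \<longlonglongrightarrow> u"
  by (auto simp: form_convergent_def)

text \<open>The definite description in \<open>closed_form\<close> is resolved here:
  \<open>form_Cauchy\<close> gives existence of the limit and \<open>form_limit_unique\<close> its
  independence of the sequences, both carried over from the shifted form by subtracting
  \<open>l * (u \<bullet> v)\<close>. The properties of the form below follow by passage to the
  limit.\<close>

lemma tendsto_closed_form:
  assumes s: "form_convergent S s u" and t: "form_convergent S t v"
  shows "(\<lambda>n. rel_app S (s n) \<bullet> t n) \<longlonglongrightarrow> closed_form S u v"
proof -
  define l where "l = \<omega> + 1"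
  have shift: "(\<lambda>n. shifted l (s n) \<bullet> t n) \<longlonglongrightarrow> x + l * (u \<bullet> v) \<longleftrightarrow> (\<lambda>n. rel_app S (s n) \<bullet> t n) \<longlonglongrightarrow> x"
    if "form_convergent S s u" "form_convergent S t v" for s t x
  proof -
    have lim: "(\<lambda>n. l * (s n \<bullet> t n)) \<longlonglongrightarrow> l * (u \<bullet> v)"
      using that by (intro tendsto_intros form_convergentD(2))
    have "(\<lambda>n. shifted l (s n) \<bullet> t n) = (\<lambda>n. rel_app S (s n) \<bullet> t n + l * (s n \<bullet> t n))"
      by (simp add: inner_add_left)
    then show ?thesis using tendsto_add[OF _ lim] tendsto_diff[OF _ lim] by fastforce
  qed
  obtain x where x: "(\<lambda>n. shifted l (s n) \<bullet> t n) \<longlonglongrightarrow> x"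
    using F.form_Cauchy s t unfolding form_convergent_eq convergent_def l_def by blast
  have all: "(\<lambda>n. rel_app S (s' n) \<bullet> t' n) \<longlonglongrightarrow> x - l * (u \<bullet> v)"
    if st': "form_convergent S s' u" "form_convergent S t' v" for s' t'
  proof -
    have "(\<lambda>n. shifted l (s' n) \<bullet> t' n) \<longlonglongrightarrow> x"
      using F.form_limit_unique s t st' x unfolding form_convergent_eq l_def by blast
    then show ?thesis using shift[OF st', of "x - l * (u \<bullet> v)"] by simp
  qed
  have "closed_form S u v = x - l * (u \<bullet> v)"
    unfolding closed_form_def
  proof (rule the_equality)
    show "\<forall>s t. form_convergent S s u \<longrightarrow> form_convergent S t v \<longrightarrow>
       (\<lambda>n. rel_app S (s n) \<bullet> t n) \<longlonglongrightarrow> x - l * (u \<bullet> v)" using all by blast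
    show "y = x - l * (u \<bullet> v)" if "\<forall>s t. form_convergent S s u \<longrightarrow> form_convergent S t v \<longrightarrow>
       (\<lambda>n. rel_app S (s n) \<bullet> t n) \<longlonglongrightarrow> y" for y
      using that s t all LIMSEQ_unique by blast
  qed
  then show ?thesis using all[OF s t] by simp
qed

lemma closed_form_add:
  assumes "u \<in> closed_form_domain S" "u' \<in> closed_form_domain S" "v \<in> closed_form_domain S"
  shows "closed_form S (u + u') v = closed_form S u v + closed_form S u' v"
proof -
  obtain s s' t where c: "form_convergent S s u" "form_convergent S s' u'" "form_convergent S t v"
    using assms by (auto simp: closed_form_domain_def)
  have "rel_app S (s n + s' n) \<bullet> t n = rel_app S (s n) \<bullet> t n + rel_app S (s' n) \<bullet> t n" for n
    using linear_operator_linear_on[OF linear] form_convergentD(1)[OF c(1)] form_convergentD(1)[OF c(2)]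
    by (simp add: linear_on_subspace_def inner_add_left)
  then show ?thesis
    using tendsto_closed_form[OF form_convergent_add[OF c(1,2)] c(3)]
      tendsto_add[OF tendsto_closed_form[OF c(1,3)] tendsto_closed_form[OF c(2,3)]] LIMSEQ_unique
    by (simp only:) blast
qed

lemma closed_form_scale:
  assumes "u \<in> closed_form_domain S" "v \<in> closed_form_domain S"
  shows "closed_form S (r *\<^sub>R u) v = r * closed_form S u v"
proof -
  obtain s t where c: "form_convergent S s u" "form_convergent S t v"
    using assms by (auto simp: closed_form_domain_def)
  have eq: "rel_app S (r *\<^sub>R s n) \<bullet> t n = r * (rel_app S (s n) \<bullet> t n)" for n
    using linear_operator_linear_on[OF linear] form_convergentD(1)[OF c(1)]
    by (simp add: linear_on_subspace_def)
  have "(\<lambda>n. r * (rel_app S (s n) \<bullet> t n)) \<longlonglongrightarrow> closed_form S (r *\<^sub>R u) v"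
    using tendsto_closed_form[OF form_convergent_scale[OF c(1), of r] c(2)] by (simp only: eq)
  then show ?thesis by (rule LIMSEQ_unique) (intro tendsto_mult_left tendsto_closed_form c)
qed

lemma closed_form_commute:
  assumes "u \<in> closed_form_domain S" "v \<in> closed_form_domain S"
  shows "closed_form S u v = closed_form S v u"
proof -
  obtain s t where c: "form_convergent S s u" "form_convergent S t v"
    using assms by (auto simp: closed_form_domain_def)
  have "rel_app S (s n) \<bullet> t n = rel_app S (t n) \<bullet> s n" for n
    using symmetric rel_app_mem[OF single form_convergentD(1)[OF c(1)]] rel_app_mem[OF single form_convergentD(1)[OF c(2)]]
    unfolding symmetric_operator_def by (fastforce simp: inner_commute)
  then show ?thesis
    using tendsto_closed_form[OF c] tendsto_closed_form[OF c(2,1)] LIMSEQ_unique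
    by (simp only:) blast
qed

lemma closed_form_ge:
  assumes "u \<in> closed_form_domain S"
  shows "- \<omega> * (norm u)\<^sup>2 \<le> closed_form S u u"
proof -
  obtain s where c: "form_convergent S s u"
    using assms by (auto simp: closed_form_domain_def)
  show ?thesis
  proof (rule LIMSEQ_le[OF _ tendsto_closed_form[OF c c]])
    show "(\<lambda>n. - \<omega> * (norm (s n))\<^sup>2) \<longlonglongrightarrow> - \<omega> * (norm u)\<^sup>2"
      by (intro tendsto_intros form_convergentD(2)[OF c])
    show "\<exists>N. \<forall>n\<ge>N. - \<omega> * (norm (s n))\<^sup>2 \<le> rel_app S (s n) \<bullet> s n"
      using bounded rel_app_mem[OF single form_convergentD(1)[OF c]] unfolding bounded_below_def by blast
  qed
qed

lemma Domain_subset_closed_form_domain: "Domain S \<subseteq> closed_form_domain S"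
  using form_convergent_const by (auto simp: closed_form_domain_def)

lemma subspace_closed_form_domain: "subspace (closed_form_domain S)"
  unfolding subspace_def closed_form_domain_def
  using form_convergent_add form_convergent_scale form_convergent_const F.D_0 by blast

section \<open>The operator associated with the closed form\<close>

lemma Friedrichs_linear: "linear_operator (Friedrichs_extension S)"
  unfolding linear_operator_def
proof
  note sub = subspace_add[OF subspace_closed_form_domain] subspace_scale[OF subspace_closed_form_domain]
    subspace_0[OF subspace_closed_form_domain]
  \<comment> \<open>Scaling 0 by 0 shows that the form vanishes at 0, which places
    \<open>(0, 0)\<close> in the graph.\<close>
  show "subspace (Friedrichs_extension S)"
    unfolding subspace_def Friedrichs_extension_def
    using closed_form_scale[of 0 _ 0]
    by (auto simp: zero_prod_def sub closed_form_add closed_form_scale inner_add_left)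
  show "single_valued (Friedrichs_extension S)"
  proof (rule single_valuedI)
    fix u w w' assume w: "(u, w) \<in> Friedrichs_extension S" "(u, w') \<in> Friedrichs_extension S"
    \<comment> \<open>Two images of \<open>u\<close> differ by a vector orthogonal to the dense
      \<open>Domain S\<close>.\<close>
    have "w - w' = 0"
    proof (rule eq_0_of_orthogonal_dense)
      show "closure (Domain S) = UNIV" using dense by (simp add: densely_defined_def)
      show "(w - w') \<bullet> v = 0" if "v \<in> Domain S" for v
        using w that Domain_subset_closed_form_domain
        by (auto simp: Friedrichs_extension_def inner_diff_left subset_iff)
    qed
    then show "w = w'" by simp
  qed
qed

lemma Friedrichs_symmetric: "symmetric_operator (Friedrichs_extension S)"
proof -
  have "w \<bullet> v = u \<bullet> z" if "(u, w) \<in> Friedrichs_extension S" "(v, z) \<in> Friedrichs_extension S" for u w v z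
    using that closed_form_commute[of u v] by (auto simp: Friedrichs_extension_def inner_commute)
  then show ?thesis unfolding symmetric_operator_def by blast
qed

lemma Friedrichs_bounded_below: "bounded_below (- \<omega>) (Friedrichs_extension S)"
proof -
  have "- \<omega> * (norm u)\<^sup>2 \<le> w \<bullet> u" if "(u, w) \<in> Friedrichs_extension S" for u w
    using that closed_form_ge[of u] by (auto simp: Friedrichs_extension_def)
  then show ?thesis unfolding bounded_below_def by blast
qed

text \<open>Weak solution: \<open>Riesz_sequence\<close> for the functional
  \<open>f \<bullet> v\<close> and the form shifted by \<open>l\<close> yields \<open>u\<close> in
  the closed form domain, and the Euler equation passes to the limit as
  \<open>closed_form S u v = (f - l *\<^sub>R u) \<bullet> v\<close>.\<close>

lemma Friedrichs_surj:
  assumes "\<omega> < l"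
  obtains u w where "(u, w) \<in> Friedrichs_extension S" "w + l *\<^sub>R u = f"
proof -
  interpret L: coercive_operator "Domain S" "shifted l" "l - \<omega>" by (rule coercive[OF assms])
  have lin: "linear_on_subspace (Domain S) (\<lambda>v. f \<bullet> v)"
    by (simp add: linear_on_subspace_def inner_add_right)
  have bound: "\<bar>f \<bullet> v\<bar> \<le> norm f * norm v" for v by (rule Cauchy_Schwarz_ineq2)
  obtain s u where "L.en_convergent s u"
    "\<And>t v. L.en_convergent t v \<Longrightarrow> (\<lambda>n. shifted l (s n) \<bullet> t n - f \<bullet> t n) \<longlonglongrightarrow> 0"
    using L.Riesz_sequence[OF lin bound] by blast
  then have s: "form_convergent S s u"
    "\<And>t v. form_convergent S t v \<Longrightarrow> (\<lambda>n. shifted l (s n) \<bullet> t n - f \<bullet> t n) \<longlonglongrightarrow> 0"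
    unfolding form_convergent_iff[OF assms] by blast+
  have "closed_form S u v = (f - l *\<^sub>R u) \<bullet> v" if v: "v \<in> closed_form_domain S" for v
  proof -
    obtain t where t: "form_convergent S t v" using v by (auto simp: closed_form_domain_def)
    have "(\<lambda>n. rel_app S (s n) \<bullet> t n + l * (s n \<bullet> t n) - f \<bullet> t n) \<longlonglongrightarrow> 
        closed_form S u v + l * (u \<bullet> v) - f \<bullet> v"
      by (intro tendsto_intros tendsto_closed_form s(1) t form_convergentD(2)[OF s(1)] form_convergentD(2)[OF t])
    moreover have "(\<lambda>n. rel_app S (s n) \<bullet> t n + l * (s n \<bullet> t n) - f \<bullet> t n) \<longlonglongrightarrow> 0"
      using s(2)[OF t] by (simp add: inner_add_left)
    ultimately have "closed_form S u v + l * (u \<bullet> v) - f \<bullet> v = 0" by (rule LIMSEQ_unique)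
    then show ?thesis by (simp add: inner_diff_left)
  qed
  then have "(u, f - l *\<^sub>R u) \<in> Friedrichs_extension S"
    using s(1) by (auto simp: Friedrichs_extension_def closed_form_domain_def)
  then show ?thesis by (rule that) simp
qed

end

subsection \<open>The extensions \<open>A\<^sub>\<Theta>\<close>\<close>

text \<open>Interface between the Friedrichs extension and the nonlinear construction.
  \<open>A_surj\<close> makes the resolvent everywhere defined for \<open>l > \<omega>\<close>;
  \<open>\<tau>_kernel_dense\<close> carries the density of \<open>Domain S\<close>.\<close>

locale boundary_map =
  fixes A :: "('a::{real_inner,complete_space} \<times> 'a) set" and \<omega> :: real
    and \<tau> :: "'a \<Rightarrow> 'b::{real_inner,complete_space}"
  assumes A_linear: "linear_operator A" and A_symmetric: "symmetric_operator A"
    and A_bounded: "bounded_below (- \<omega>) A"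
    and A_surj: "\<omega> < l \<Longrightarrow> \<exists>u w. (u, w) \<in> A \<and> w + l *\<^sub>R u = f"
    and \<tau>_linear: "linear_on_subspace (Domain A) \<tau>"
    and \<tau>_continuous: "continuous_map (graph_topology A) euclidean \<tau>"
    and \<tau>_surj: "\<tau> ` Domain A = UNIV"
    and \<tau>_kernel_dense: "closure {u \<in> Domain A. \<tau> u = 0} = UNIV"
begin

abbreviation "R \<equiv> resolvent A"
abbreviation "G \<equiv> G_map A \<tau>"

lemma A_single: "single_valued A" using A_linear by (simp add: linear_operator_def)

lemmas A_mem = rel_app_mem[OF A_single]
lemmas A_eq = rel_app_eq[OF A_single]

lemma subspace_Domain: "subspace (Domain A)"
  by (rule linear_operator_subspace_Domain[OF A_linear])

lemmas Domain_add = subspace_add[OF subspace_Domain]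
lemmas Domain_diff = subspace_diff[OF subspace_Domain]
lemmas Domain_scale = subspace_scale[OF subspace_Domain]

lemma A_add: "u \<in> Domain A \<Longrightarrow> v \<in> Domain A \<Longrightarrow> rel_app A (u + v) = rel_app A u + rel_app A v"
  and A_scale: "u \<in> Domain A \<Longrightarrow> rel_app A (r *\<^sub>R u) = r *\<^sub>R rel_app A u"
  and \<tau>_add: "u \<in> Domain A \<Longrightarrow> v \<in> Domain A \<Longrightarrow> \<tau> (u + v) = \<tau> u + \<tau> v"
  and \<tau>_scale: "u \<in> Domain A \<Longrightarrow> \<tau> (r *\<^sub>R u) = r *\<^sub>R \<tau> u"
  using linear_operator_linear_on[OF A_linear] \<tau>_linear by (auto simp: linear_on_subspace_def)

lemma A_diff: "u \<in> Domain A \<Longrightarrow> v \<in> Domain A \<Longrightarrow> rel_app A (u - v) = rel_app A u - rel_app A v"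
  using A_add[of u "(-1) *\<^sub>R v"] A_scale[of v "-1"] Domain_scale[of v "-1"] by simp

lemma \<tau>_diff: "u \<in> Domain A \<Longrightarrow> v \<in> Domain A \<Longrightarrow> \<tau> (u - v) = \<tau> u - \<tau> v"
  using \<tau>_add[of u "(-1) *\<^sub>R v"] \<tau>_scale[of v "-1"] Domain_scale[of v "-1"] by simp

lemma A_sym: "u \<in> Domain A \<Longrightarrow> v \<in> Domain A \<Longrightarrow> rel_app A u \<bullet> v = u \<bullet> rel_app A v"
  using A_symmetric A_mem unfolding symmetric_operator_def by blast

lemma A_coercive:
  assumes "u \<in> Domain A" shows "(l - \<omega>) * (norm u)\<^sup>2 \<le> (rel_app A u + l *\<^sub>R u) \<bullet> u"
proof -
  have "- \<omega> * (norm u)\<^sup>2 \<le> rel_app A u \<bullet> u"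
    using A_bounded A_mem[OF assms] unfolding bounded_below_def by blast
  then show ?thesis by (simp add: inner_add_left power2_norm_eq_inner left_diff_distrib)
qed

lemma A_shift_nonneg: "\<omega> < l \<Longrightarrow> u \<in> Domain A \<Longrightarrow> 0 \<le> (rel_app A u + l *\<^sub>R u) \<bullet> u"
  by (rule order_trans[OF _ A_coercive]) auto

lemma A_shift_inj:
  assumes "\<omega> < l" "u \<in> Domain A" "v \<in> Domain A"
    and "rel_app A u + l *\<^sub>R u = rel_app A v + l *\<^sub>R v"
  shows "u = v"
proof -
  have "rel_app A (u - v) + l *\<^sub>R (u - v) = (rel_app A u + l *\<^sub>R u) - (rel_app A v + l *\<^sub>R v)"
    using assms(2,3) by (simp add: A_diff scaleR_diff_right)
  then have "rel_app A (u - v) + l *\<^sub>R (u - v) = 0" using assms(4) by simp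
  then have "(l - \<omega>) * (norm (u - v))\<^sup>2 \<le> 0" using A_coercive[of "u - v" l] Domain_diff assms by simp
  then show ?thesis using assms by (simp add: mult_le_0_iff)
qed

section \<open>The linear resolvent\<close>

lemma resolvent_shift:
  assumes "\<omega> < l" "u \<in> Domain A" shows "R l (rel_app A u + l *\<^sub>R u) = u"
proof -
  \<comment> \<open>Injectivity of the shifted operator is what makes \<open>rel_app\<close> of the
    inverse relation meaningful.\<close>
  have "single_valued (resolvent_relation A l)"
    using A_shift_inj[OF \<open>\<omega> < l\<close>] A_eq
    by (force simp: resolvent_relation_def rel_plus_def intro: single_valuedI)
  then show ?thesis unfolding resolvent_def
    by (rule rel_app_eq) (use A_mem assms in \<open>auto simp: resolvent_relation_def rel_plus_def\<close>)
qed

lemma resolvent_mem: "\<omega> < l \<Longrightarrow> R l f \<in> Domain A"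
  and shift_resolvent: "\<omega> < l \<Longrightarrow> rel_app A (R l f) + l *\<^sub>R R l f = f"
proof -
  assume l: "\<omega> < l"
  obtain u w where u: "(u, w) \<in> A" "w + l *\<^sub>R u = f" using A_surj[OF l] by blast
  have "u \<in> Domain A" "rel_app A u + l *\<^sub>R u = f" using u A_eq by auto
  moreover from this have "R l f = u" using resolvent_shift[OF l] by metis
  ultimately show "R l f \<in> Domain A" "rel_app A (R l f) + l *\<^sub>R R l f = f" by simp_all
qed

lemma resolvent_add: "\<omega> < l \<Longrightarrow> R l (f + g) = R l f + R l g"
proof (rule A_shift_inj)
  assume l: "\<omega> < l"
  have "rel_app A (R l f + R l g) + l *\<^sub>R (R l f + R l g) =
      (rel_app A (R l f) + l *\<^sub>R R l f) + (rel_app A (R l g) + l *\<^sub>R R l g)"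
    using l by (simp add: resolvent_mem A_add scaleR_add_right)
  then show "rel_app A (R l (f + g)) + l *\<^sub>R R l (f + g) =
      rel_app A (R l f + R l g) + l *\<^sub>R (R l f + R l g)"
    using l by (simp add: shift_resolvent)
qed (auto simp: resolvent_mem Domain_add)

lemma resolvent_scale: "\<omega> < l \<Longrightarrow> R l (r *\<^sub>R f) = r *\<^sub>R R l f"
proof (rule A_shift_inj)
  assume l: "\<omega> < l"
  have "rel_app A (r *\<^sub>R R l f) + l *\<^sub>R r *\<^sub>R R l f = r *\<^sub>R (rel_app A (R l f) + l *\<^sub>R R l f)"
    using l by (simp add: resolvent_mem A_scale scaleR_add_right mult.commute)
  then show "rel_app A (R l (r *\<^sub>R f)) + l *\<^sub>R R l (r *\<^sub>R f) = rel_app A (r *\<^sub>R R l f) + l *\<^sub>R r *\<^sub>R R l f"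
    using l by (simp add: shift_resolvent)
qed (auto simp: resolvent_mem Domain_scale)

lemma resolvent_norm_le:
  assumes "\<omega> < l" shows "norm (R l f) \<le> norm f / (l - \<omega>)"
proof -
  have "(l - \<omega>) * (norm (R l f))\<^sup>2 \<le> f \<bullet> R l f"
    using A_coercive[OF resolvent_mem[OF assms], of l f] by (simp add: shift_resolvent[OF assms])
  also have "\<dots> \<le> norm f * norm (R l f)" by (rule norm_cauchy_schwarz)
  finally have "(l - \<omega>) * norm (R l f) * norm (R l f) \<le> norm f * norm (R l f)"
    by (simp add: power2_eq_square mult.assoc)
  then have "(l - \<omega>) * norm (R l f) \<le> norm f" by (cases "R l f = 0") auto
  then show ?thesis using assms by (simp add: field_simps)
qed

lemma resolvent_symmetric:
  assumes "\<omega> < l" shows "R l f \<bullet> g = f \<bullet> R l g"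
proof -
  note D = resolvent_mem[OF assms]
  have "R l f \<bullet> g = R l f \<bullet> (rel_app A (R l g) + l *\<^sub>R R l g)" by (simp add: shift_resolvent assms)
  also have "\<dots> = (rel_app A (R l f) + l *\<^sub>R R l f) \<bullet> R l g"
    using A_sym[OF D D] by (simp add: inner_add)
  also have "\<dots> = f \<bullet> R l g" by (simp add: shift_resolvent assms)
  finally show ?thesis .
qed

lemma resolvent_identity:
  assumes "\<omega> < l" "\<omega> < l0" shows "R l f = R l0 f - (l - l0) *\<^sub>R R l0 (R l f)"
proof -
  \<comment> \<open>The shift by \<open>l\<close> is split into the shift by \<open>l0\<close> and
    the rest; then \<open>R l0\<close> is applied.\<close>
  have "f = (rel_app A (R l f) + l0 *\<^sub>R R l f) + (l - l0) *\<^sub>R R l f"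
    using shift_resolvent[OF assms(1), of f] by (simp add: algebra_simps)
  then have "R l0 f = R l0 (rel_app A (R l f) + l0 *\<^sub>R R l f) + R l0 ((l - l0) *\<^sub>R R l f)"
    using resolvent_add[OF assms(2)] by metis
  then show ?thesis using assms by (simp add: resolvent_shift resolvent_mem resolvent_scale)
qed

section \<open>The graph norm and boundedness of \<tau>\<close>

lemma graph_norm_eq: "graph_norm A u = norm (rel_app A u, u)"
  by (simp add: graph_norm_def graph_inner_def norm_Pair power2_norm_eq_inner)

lemma graph_norm_uminus: "graph_norm A (- u) = graph_norm A u"
proof (cases "u \<in> Domain A")
  case True
  then show ?thesis using A_scale[of u "-1"] by (simp add: graph_norm_eq norm_Pair)
next
  case False
  \<comment> \<open>both applications of \<^const>\<open>rel_app\<close> are then the same junk value\<close>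
  have "- u \<notin> Domain A" using False subspace_neg[OF subspace_Domain, of "- u"] by auto
  with False have "(\<lambda>w. (- u, w) \<in> A) = (\<lambda>w. (u, w) \<in> A)" by auto
  then show ?thesis by (simp add: graph_norm_eq norm_Pair rel_app_def)
qed

lemma graph_metric: "Metric_space (Domain A) (\<lambda>u v. graph_norm A (u - v))"
proof
  show "0 \<le> graph_norm A (u - v)" for u v by (simp add: graph_norm_eq)
  \<comment> \<open>\<open>Metric_space\<close> demands symmetry at all points, also outside
    \<open>Domain A\<close>.\<close>
  show "graph_norm A (u - v) = graph_norm A (v - u)" for u v
    using graph_norm_uminus[of "u - v"] by simp
  have dist: "graph_norm A (u - v) = dist (rel_app A u, u) (rel_app A v, v)"
    if "u \<in> Domain A" "v \<in> Domain A" for u v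
    using that by (simp add: graph_norm_eq A_diff dist_norm)
  show "graph_norm A (u - v) = 0 \<longleftrightarrow> u = v" if "u \<in> Domain A" "v \<in> Domain A" for u v
    using that by (auto simp: dist)
  show "graph_norm A (u - w) \<le> graph_norm A (u - v) + graph_norm A (v - w)"
    if "u \<in> Domain A" "v \<in> Domain A" "w \<in> Domain A" for u v w
    using that by (simp add: dist dist_triangle)
qed

text \<open>Continuity at 0 in the graph norm, with tolerance 1, spreads over
  \<open>Domain A\<close> by homogeneity.\<close>

lemma \<tau>_bounded:
  obtains C where "0 < C" "\<And>u. u \<in> Domain A \<Longrightarrow> norm (\<tau> u) \<le> C * (norm (rel_app A u) + norm u)"
proof -
  interpret M: Metric_space "Domain A" "\<lambda>u v. graph_norm A (u - v)" by (rule graph_metric)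
  have D0: "0 \<in> Domain A" by (rule subspace_0[OF subspace_Domain])
  have \<tau>0: "\<tau> 0 = 0" using \<tau>_scale[OF D0, of 0] by simp
  have "continuous_map M.mtopology Met_TC.mtopology \<tau>"
    using \<tau>_continuous by (simp add: graph_topology_def)
  then have "\<forall>a\<in>Domain A. \<forall>\<epsilon>>0. \<exists>\<delta>>0. \<forall>x. x \<in> Domain A \<and> graph_norm A (a - x) < \<delta> \<longrightarrow> dist (\<tau> a) (\<tau> x) < \<epsilon>"
    using M.metric_continuous_map[OF Met_TC.Metric_space_axioms] by blast
  then obtain d where d: "0 < d" "\<And>x. x \<in> Domain A \<Longrightarrow> graph_norm A (0 - x) < d \<Longrightarrow> dist (\<tau> 0) (\<tau> x) < 1"
    using D0 zero_less_one by meson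
  have d': "norm (\<tau> x) < 1" if "x \<in> Domain A" "graph_norm A x < d" for x
    using d(2)[of x] that graph_norm_uminus[of x] by (simp add: \<tau>0)
  have "norm (\<tau> u) \<le> 2 / d * (norm (rel_app A u) + norm u)" if u: "u \<in> Domain A" for u
  proof (cases "u = 0")
    case False
    have pos: "0 < graph_norm A u" using False by (simp add: graph_norm_eq zero_prod_def)
    \<comment> \<open>Places \<open>r *\<^sub>R u\<close> at graph norm \<open>d / 2\<close>,
      strictly inside the ball of radius \<open>d\<close>.\<close>
    define r where "r = d / (2 * graph_norm A u)"
    have r: "0 < r" using pos d by (simp add: r_def)
    have "graph_norm A (r *\<^sub>R u) = norm (r *\<^sub>R (rel_app A u, u))" 
      by (simp only: graph_norm_eq A_scale[OF u] scaleR_Pair)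
    also have "\<dots> = d / 2" unfolding norm_scaleR graph_norm_eq[symmetric] using pos r d by (simp add: r_def)
    finally have "norm (\<tau> (r *\<^sub>R u)) < 1" using d u by (intro d' Domain_scale) auto
    then have "r * norm (\<tau> u) < 1" using r by (simp add: \<tau>_scale u)
    then have "norm (\<tau> u) \<le> 2 / d * graph_norm A u" using pos d by (simp add: r_def field_simps)
    also have "\<dots> \<le> 2 / d * (norm (rel_app A u) + norm u)"
      unfolding graph_norm_eq using d by (intro mult_left_mono) (auto simp: norm_Pair sqrt_sum_squares_le_sum)
    finally show ?thesis .
  qed (use d in \<open>simp add: \<tau>0\<close>)
  then show ?thesis using that[of "2 / d"] d by simp
qed

section \<open>The maps \<open>G l\<close>\<close>

text \<open>\<open>rel_app A (R l f) = f - l *\<^sub>R R l f\<close> bounds the graph norm of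
  \<open>R l f\<close> by a multiple of \<open>norm f\<close>.\<close>

lemma bounded_linear_\<tau>_resolvent:
  assumes "\<omega> < l" shows "bounded_linear (\<tau> \<circ> R l)"
proof -
  obtain C where C: "0 < C" "\<And>u. u \<in> Domain A \<Longrightarrow> norm (\<tau> u) \<le> C * (norm (rel_app A u) + norm u)"
    using \<tau>_bounded by blast
  show ?thesis
  proof (rule bounded_linear_intro)
    show "(\<tau> \<circ> R l) (f + g) = (\<tau> \<circ> R l) f + (\<tau> \<circ> R l) g" for f g
      using assms by (simp add: resolvent_add resolvent_mem \<tau>_add)
    show "(\<tau> \<circ> R l) (r *\<^sub>R f) = r *\<^sub>R (\<tau> \<circ> R l) f" for r f
      using assms by (simp add: resolvent_scale resolvent_mem \<tau>_scale)
    show "norm ((\<tau> \<circ> R l) f) \<le> norm f * (C * (1 + (\<bar>l\<bar> + 1) / (l - \<omega>)))" for f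
    proof -
      have "rel_app A (R l f) = f - l *\<^sub>R R l f" using shift_resolvent[OF assms, of f] by (simp add: algebra_simps)
      then have "norm (rel_app A (R l f)) \<le> norm f + \<bar>l\<bar> * norm (R l f)"
        using norm_triangle_ineq4[of f "l *\<^sub>R R l f"] by simp
      then have "norm (rel_app A (R l f)) + norm (R l f) \<le> norm f + (\<bar>l\<bar> + 1) * norm (R l f)"
        by (simp add: distrib_right)
      also have "\<dots> \<le> norm f + (\<bar>l\<bar> + 1) * (norm f / (l - \<omega>))"
        using resolvent_norm_le[OF assms] by (intro add_mono mult_left_mono) auto
      finally have "C * (norm (rel_app A (R l f)) + norm (R l f)) \<le> C * (norm f + (\<bar>l\<bar> + 1) * (norm f / (l - \<omega>)))"
        using C by (intro mult_left_mono) auto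
      then have "norm (\<tau> (R l f)) \<le> C * (norm f + (\<bar>l\<bar> + 1) * (norm f / (l - \<omega>)))"
        using C(2)[OF resolvent_mem[OF assms], of f] by linarith
      then show ?thesis by (simp add: algebra_simps)
    qed
  qed
qed

lemma surj_\<tau>_resolvent: "\<omega> < l \<Longrightarrow> surj (\<tau> \<circ> R l)"
proof -
  assume l: "\<omega> < l"
  have "\<exists>f. y = \<tau> (R l f)" for y
  proof -
    obtain u where "u \<in> Domain A" "y = \<tau> u" using \<tau>_surj by (metis UNIV_I imageE)
    then show ?thesis using resolvent_shift[OF l] by metis
  qed
  then show ?thesis unfolding surj_def by simp
qed

lemma bounded_linear_G: "\<omega> < l \<Longrightarrow> bounded_linear (G l)"
  unfolding G_map_def by (intro bounded_linear_adjoint bounded_linear_\<tau>_resolvent)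

lemma inner_G: "\<omega> < l \<Longrightarrow> f \<bullet> G l \<xi> = \<tau> (R l f) \<bullet> \<xi>"
  unfolding G_map_def using inner_adjoint[OF bounded_linear_\<tau>_resolvent, of l f \<xi>] by simp

text \<open>\<open>G l\<close> is itself an adjoint, and uniqueness of adjoints returns the original
  map.\<close>

lemma adjoint_G: "\<omega> < l \<Longrightarrow> adjoint (G l) = \<tau> \<circ> R l"
  by (rule adjoint_unique) (simp add: inner_commute[of "G l _"] inner_G inner_commute)

text \<open>The resolvent identity composed with \<tau> and transposed; testing with
  \<open>f\<close> lets the symmetric \<open>R l\<close> cross the inner product.\<close>

lemma G_resolvent_identity:
  assumes "\<omega> < l" "\<omega> < l0" shows "G l \<xi> = G l0 \<xi> - (l - l0) *\<^sub>R R l (G l0 \<xi>)"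
proof (rule vector_eq_ldot[THEN iffD1], rule allI)
  fix f
  have "f \<bullet> G l \<xi> = \<tau> (R l0 f - (l - l0) *\<^sub>R R l0 (R l f)) \<bullet> \<xi>"
    using assms resolvent_identity[OF assms, of f] by (simp add: inner_G)
  also have "\<dots> = \<tau> (R l0 f) \<bullet> \<xi> - (l - l0) * (\<tau> (R l0 (R l f)) \<bullet> \<xi>)"
    using assms by (simp add: resolvent_mem Domain_scale \<tau>_diff \<tau>_scale inner_diff_left)
  also have "\<dots> = f \<bullet> (G l0 \<xi> - (l - l0) *\<^sub>R R l (G l0 \<xi>))"
    using assms by (simp add: inner_G[symmetric] inner_diff_right resolvent_symmetric)
  finally show "f \<bullet> G l \<xi> = f \<bullet> (G l0 \<xi> - (l - l0) *\<^sub>R R l (G l0 \<xi>))" .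
qed

text \<open>\<open>G l\<close> is \<open>G l0\<close> followed by a symmetric operator built from
  \<open>R l\<close>, so \<open>G l0 \<xi> \<bullet> G l \<zeta>\<close> is symmetric in \<xi> and
  \<zeta>. This reconciles the order of factors in \<open>M_relation\<close> with the one arising
  from \<open>\<tau> (R l (G l0 \<xi>))\<close>.\<close>

lemma adjoint_G_G_commute:
  assumes "\<omega> < l" "\<omega> < l0" shows "adjoint (G l) (G l0 \<xi>) = adjoint (G l0) (G l \<xi>)"
proof (rule vector_eq_rdot[THEN iffD1], rule allI)
  fix \<zeta>
  have "adjoint (G l) (G l0 \<xi>) \<bullet> \<zeta> = G l0 \<xi> \<bullet> G l \<zeta>" using assms by (simp add: adjoint_G inner_G)
  also have "\<dots> = G l \<xi> \<bullet> G l0 \<zeta>"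
    unfolding G_resolvent_identity[OF assms]
    using resolvent_symmetric[OF assms(1), of "G l0 \<xi>" "G l0 \<zeta>"] by (simp add: inner_diff)
  also have "\<dots> = adjoint (G l0) (G l \<xi>) \<bullet> \<zeta>" using assms by (simp add: adjoint_G inner_G)
  finally show "adjoint (G l) (G l0 \<xi>) \<bullet> \<zeta> = adjoint (G l0) (G l \<xi>) \<bullet> \<zeta>" .
qed

text \<open>With \<open>v = R l (G l0 \<xi>)\<close> one has \<open>G l \<xi> = (A + l0) v\<close> and \<open>G l0 \<xi> = (A + l) v\<close>.\<close>

lemma adjoint_G_G_ge:
  assumes "\<omega> < l0" "l0 \<le> l" shows "(norm (G l \<xi>))\<^sup>2 \<le> adjoint (G l0) (G l \<xi>) \<bullet> \<xi>"
proof -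
  have l: "\<omega> < l" using assms by simp
  define v where "v = R l (G l0 \<xi>)"
  have v: "v \<in> Domain A" "rel_app A v + l *\<^sub>R v = G l0 \<xi>"
    using l by (simp_all add: v_def resolvent_mem shift_resolvent)
  have "G l \<xi> = G l0 \<xi> - (l - l0) *\<^sub>R v"
    unfolding v_def by (rule G_resolvent_identity[OF l assms(1)])
  also have "\<dots> = rel_app A v + l0 *\<^sub>R v" unfolding v(2)[symmetric] by (simp add: algebra_simps)
  finally have Gl: "G l \<xi> = rel_app A v + l0 *\<^sub>R v" .
  have "G l0 \<xi> = G l \<xi> + (l - l0) *\<^sub>R v" using v(2) by (simp add: Gl algebra_simps)
  then have "G l \<xi> \<bullet> G l0 \<xi> = (norm (G l \<xi>))\<^sup>2 + (l - l0) * (G l \<xi> \<bullet> v)"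
    by (simp add: inner_add_right power2_norm_eq_inner)
  moreover have "0 \<le> (l - l0) * (G l \<xi> \<bullet> v)"
    using assms A_shift_nonneg[OF assms(1) v(1)] by (simp add: Gl)
  ultimately show ?thesis using assms by (simp add: adjoint_G inner_G)
qed

lemma G_bounded_below:
  assumes "\<omega> < l" obtains c where "0 < c" "\<And>\<xi>. c * norm \<xi> \<le> norm (G l \<xi>)"
proof -
  have "(\<tau> \<circ> R l) f \<bullet> \<xi> = f \<bullet> G l \<xi>" for f \<xi> by (simp add: inner_G assms)
  from bounded_below_of_surj_adjoint[OF surj_\<tau>_resolvent[OF assms]
      bounded_linear.linear[OF bounded_linear_G[OF assms]] this] that
  show ?thesis by blast
qed

text \<open>If \<open>G l \<xi>\<close> lies in the domain, symmetry moves the shifted operator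
  across: \<open>w \<bullet> v = \<tau> v \<bullet> \<xi>\<close>, which vanishes on the dense
  kernel of \<tau>. Hence \<open>w = 0\<close>, so \<open>G l \<xi> = 0\<close>, and
  \<open>G l\<close> is injective.\<close>

lemma G_eq_0_of_mem_Domain:
  assumes "\<omega> < l" "G l \<xi> \<in> Domain A" shows "\<xi> = 0"
proof -
  define w where "w = rel_app A (G l \<xi>) + l *\<^sub>R G l \<xi>"
  have orth: "w \<bullet> v = 0" if "v \<in> Domain A" "\<tau> v = 0" for v
  proof -
    have "w \<bullet> v = (rel_app A v + l *\<^sub>R v) \<bullet> G l \<xi>"
      using A_sym[OF assms(2) that(1)] by (simp add: w_def inner_add inner_commute)
    also have "\<dots> = \<tau> v \<bullet> \<xi>" using that assms by (simp add: inner_G resolvent_shift)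
    finally show ?thesis using that by simp
  qed
  have "w = 0" by (rule eq_0_of_orthogonal_dense[OF \<tau>_kernel_dense]) (use orth in auto)
  then have "G l \<xi> = R l 0" using resolvent_shift[OF assms] by (simp add: w_def)
  also have "\<dots> = 0" using resolvent_scale[OF assms(1), of 0 0] by simp
  finally have "G l \<xi> = 0" .
  then show ?thesis using G_bounded_below[OF assms(1)]
    by (metis mult_le_0_iff norm_le_zero_iff norm_zero not_le)
qed

section \<open>The relation \<open>M_relation\<close> and the nonlinear operator\<close>

context
  fixes \<Theta> :: "('b \<times> 'b) set" and l0 :: real
  assumes \<Theta>: "maximal_monotone_relation \<Theta>" and l0: "\<omega> < l0"
begin

definition Q :: "real \<Rightarrow> 'b \<Rightarrow> 'b" where "Q l \<xi> = (l - l0) *\<^sub>R adjoint (G l0) (G l \<xi>)"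

lemma M_eq: "M_relation A \<tau> \<Theta> l0 l = rel_plus \<Theta> (Q l)"
  by (simp add: M_relation_def Q_def[abs_def])

lemma bounded_linear_Q: "l0 \<le> l \<Longrightarrow> bounded_linear (Q l)"
  unfolding Q_def[abs_def]
  using l0 by (intro bounded_linear_compose[OF bounded_linear_scaleR_right]
      bounded_linear_compose[OF bounded_linear_adjoint] bounded_linear_G) auto

lemma Q_ge: "l0 \<le> l \<Longrightarrow> (l - l0) * (norm (G l \<xi>))\<^sup>2 \<le> Q l \<xi> \<bullet> \<xi>"
  using adjoint_G_G_ge[OF l0, of l \<xi>] by (simp add: Q_def mult_left_mono)

lemma M_maximal_monotone:
  assumes "l0 \<le> l" shows "maximal_monotone_relation (M_relation A \<tau> \<Theta> l0 l)"
  unfolding M_eq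
proof (rule maximal_monotone_rel_plus[OF \<Theta> bounded_linear_Q[OF assms]])
  show "0 \<le> Q l \<xi> \<bullet> \<xi>" for \<xi>
    by (rule order_trans[OF _ Q_ge[OF assms]]) (use assms in simp)
qed

text \<open>The lower bound \<open>c\<close> of \<open>G l\<close> makes \<open>Q l\<close> coercive
  with constant \<open>(l - l0) * c\<^sup>2\<close>, positive because \<open>l0 < l\<close>.
  Coercivity gives a solution, and together with the monotonicity of \<Theta> its
  uniqueness.\<close>

lemma M_bijective:
  assumes "l0 < l" shows "\<exists>!\<xi>. (\<eta>, \<xi>) \<in> (M_relation A \<tau> \<Theta> l0 l)\<inverse>"
proof -
  obtain c where c: "0 < c" "\<And>\<xi>. c * norm \<xi> \<le> norm (G l \<xi>)"
    using G_bounded_below[of l] assms l0 by auto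
  have coercive: "((l - l0) * c\<^sup>2) * (norm \<xi>)\<^sup>2 \<le> Q l \<xi> \<bullet> \<xi>" for \<xi>
  proof -
    have "(c * norm \<xi>)\<^sup>2 \<le> (norm (G l \<xi>))\<^sup>2" using c by (intro power_mono) auto
    then have "(l - l0) * (c * norm \<xi>)\<^sup>2 \<le> (l - l0) * (norm (G l \<xi>))\<^sup>2"
      using assms by (intro mult_left_mono) auto
    also have "\<dots> \<le> Q l \<xi> \<bullet> \<xi>" using assms by (intro Q_ge) simp
    finally show ?thesis by (simp add: power_mult_distrib mult.assoc)
  qed
  have pos: "0 < (l - l0) * c\<^sup>2" using assms c by simp
  have Q: "bounded_linear (Q l)" using assms by (intro bounded_linear_Q) simp
  obtain \<xi> \<xi>' where "(\<xi>, \<xi>') \<in> \<Theta>" "\<xi>' + Q l \<xi> = \<eta>"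
    by (rule maximal_monotone_plus_coercive_surj[OF \<Theta> Q pos coercive])
  then have "(\<eta>, \<xi>) \<in> (M_relation A \<tau> \<Theta> l0 l)\<inverse>" by (auto simp: M_eq rel_plus_def)
  moreover have "\<xi> = \<zeta>"
    if \<xi>: "(\<eta>, \<xi>) \<in> (M_relation A \<tau> \<Theta> l0 l)\<inverse>" "(\<eta>, \<zeta>) \<in> (M_relation A \<tau> \<Theta> l0 l)\<inverse>" for \<xi> \<zeta>
  proof -
    obtain \<xi>' \<zeta>' where x: "(\<xi>, \<xi>') \<in> \<Theta>" "\<xi>' + Q l \<xi> = \<eta>" "(\<zeta>, \<zeta>') \<in> \<Theta>" "\<zeta>' + Q l \<zeta> = \<eta>"
      using \<xi> by (auto simp: M_eq rel_plus_def)
    have "0 \<le> (\<xi>' - \<zeta>') \<bullet> (\<xi> - \<zeta>)"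
      using \<Theta> x by (intro monotone_relationD[of \<Theta>]) (auto simp: maximal_monotone_relation_def)
    moreover have "\<xi>' - \<zeta>' = - Q l (\<xi> - \<zeta>)"
      using x(2,4) by (simp add: linear_diff[OF bounded_linear.linear[OF Q]] algebra_simps)
    ultimately have "Q l (\<xi> - \<zeta>) \<bullet> (\<xi> - \<zeta>) \<le> 0" by simp
    then have "((l - l0) * c\<^sup>2) * (norm (\<xi> - \<zeta>))\<^sup>2 \<le> 0" using coercive[of "\<xi> - \<zeta>"] by linarith
    then show ?thesis using assms c by (simp add: mult_le_0_iff)
  qed
  ultimately show ?thesis by blast
qed

lemma A_operator_cases:
  assumes "(u, w) \<in> A_operator A \<tau> \<Theta> l0"
  obtains u0 \<xi> where "u0 \<in> Domain A" "(\<xi>, \<tau> u0) \<in> \<Theta>" "u = u0 + G l0 \<xi>" 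
    "w = rel_app A u0 - l0 *\<^sub>R G l0 \<xi>"
  using assms by (auto simp: A_operator_def)

text \<open>The decomposition \<open>u = u0 + G l0 \<xi>\<close> is unique: two of them differ by an
  element of the range of \<open>G l0\<close> inside \<open>Domain A\<close>.\<close>

lemma A_operator_single: "single_valued (A_operator A \<tau> \<Theta> l0)"
proof (rule single_valuedI)
  fix u w w' assume "(u, w) \<in> A_operator A \<tau> \<Theta> l0" "(u, w') \<in> A_operator A \<tau> \<Theta> l0"
  then obtain u0 \<xi> v0 \<zeta> where u: "u0 \<in> Domain A" "u = u0 + G l0 \<xi>" "w = rel_app A u0 - l0 *\<^sub>R G l0 \<xi>"
    "v0 \<in> Domain A" "u = v0 + G l0 \<zeta>" "w' = rel_app A v0 - l0 *\<^sub>R G l0 \<zeta>"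
    by (metis A_operator_cases)
  have "G l0 (\<xi> - \<zeta>) = v0 - u0"
    using u(2,5) by (simp add: linear_diff[OF bounded_linear.linear[OF bounded_linear_G[OF l0]]] algebra_simps)
  then have "\<xi> - \<zeta> = 0" using u(1,4) by (intro G_eq_0_of_mem_Domain[OF l0]) (simp add: Domain_diff)
  then show "w = w'" using u by simp
qed

text \<open>In \<open>w + l0 *\<^sub>R u\<close> the \<open>G l0\<close> terms cancel, leaving the
  shifted linear operator at \<open>u0\<close>. Pairing with \<open>u - v\<close> then splits into
  the nonnegative form at \<open>d\<close> and \<open>\<tau> d \<bullet> (\<xi> - \<zeta>)\<close>,
  nonnegative by monotonicity of \<Theta>.\<close>

lemma A_operator_monotone:
  assumes "(u, w) \<in> A_operator A \<tau> \<Theta> l0" "(v, z) \<in> A_operator A \<tau> \<Theta> l0"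
  shows "0 \<le> (w + l0 *\<^sub>R u - (z + l0 *\<^sub>R v)) \<bullet> (u - v)"
proof -
  obtain u0 \<xi> where u: "u0 \<in> Domain A" "(\<xi>, \<tau> u0) \<in> \<Theta>" "u = u0 + G l0 \<xi>" "w = rel_app A u0 - l0 *\<^sub>R G l0 \<xi>"
    using assms(1) by (rule A_operator_cases)
  obtain v0 \<zeta> where v: "v0 \<in> Domain A" "(\<zeta>, \<tau> v0) \<in> \<Theta>" "v = v0 + G l0 \<zeta>" "z = rel_app A v0 - l0 *\<^sub>R G l0 \<zeta>"
    using assms(2) by (rule A_operator_cases)
  define d where "d = u0 - v0"
  have d: "d \<in> Domain A" using u v by (simp add: d_def Domain_diff)
  have "w + l0 *\<^sub>R u - (z + l0 *\<^sub>R v) = rel_app A d + l0 *\<^sub>R d"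
    using u v by (simp add: d_def A_diff algebra_simps)
  moreover have "u - v = d + G l0 (\<xi> - \<zeta>)"
    using u v by (simp add: d_def linear_diff[OF bounded_linear.linear[OF bounded_linear_G[OF l0]]])
  ultimately have "(w + l0 *\<^sub>R u - (z + l0 *\<^sub>R v)) \<bullet> (u - v) = 
      (rel_app A d + l0 *\<^sub>R d) \<bullet> d + \<tau> d \<bullet> (\<xi> - \<zeta>)"
    using l0 d by (simp add: inner_add_right inner_G resolvent_shift)
  moreover have "0 \<le> (\<tau> u0 - \<tau> v0) \<bullet> (\<xi> - \<zeta>)"
    using \<Theta> u v by (intro monotone_relationD[of \<Theta>]) (auto simp: maximal_monotone_relation_def)
  ultimately show ?thesis using A_shift_nonneg[OF l0 d] u v by (simp add: d_def \<tau>_diff)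
qed

lemma A_operator_type: "monotone_operator_of_type l0 (A_operator A \<tau> \<Theta> l0)"
proof -
  have "- l0 * (norm (u - v))\<^sup>2 \<le> (w - z) \<bullet> (u - v)"
    if "(u, w) \<in> A_operator A \<tau> \<Theta> l0" "(v, z) \<in> A_operator A \<tau> \<Theta> l0" for u w v z
  proof -
    have eq: "w + l0 *\<^sub>R u - (z + l0 *\<^sub>R v) = (w - z) + l0 *\<^sub>R (u - v)" by (simp add: algebra_simps)
    have "0 \<le> ((w - z) + l0 *\<^sub>R (u - v)) \<bullet> (u - v)" using A_operator_monotone[OF that] unfolding eq .
    then show ?thesis by (simp add: inner_add_left power2_norm_eq_inner)
  qed
  then show ?thesis unfolding monotone_operator_of_type_def using A_operator_single by blast
qed

lemma R_map_solves:
  assumes "l0 < l"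
  obtains w where "(R_map A \<tau> \<Theta> l0 l f, w) \<in> A_operator A \<tau> \<Theta> l0" "w + l *\<^sub>R R_map A \<tau> \<Theta> l0 l f = f"
proof -
  have l: "\<omega> < l" using assms l0 by simp
  define \<xi> where "\<xi> = rel_app ((M_relation A \<tau> \<Theta> l0 l)\<inverse>) (adjoint (G l) f)"
  \<comment> \<open>Unique solvability turns the definite description into a genuine member of the
    inverse relation.\<close>
  have "(adjoint (G l) f, \<xi>) \<in> (M_relation A \<tau> \<Theta> l0 l)\<inverse>"
    unfolding \<xi>_def rel_app_def by (rule theI'[OF M_bijective[OF assms]])
  then obtain \<xi>' where \<xi>': "(\<xi>, \<xi>') \<in> \<Theta>" "\<xi>' + Q l \<xi> = adjoint (G l) f"
    by (auto simp: M_eq rel_plus_def)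
  define u where "u = R_map A \<tau> \<Theta> l0 l f"
  have u: "u = R l f + G l \<xi>" by (simp add: u_def R_map_def \<xi>_def)
  \<comment> \<open>The resolvent identity writes \<open>G l \<xi>\<close> as
    \<open>G l0 \<xi>\<close> plus a term in \<open>Domain A\<close>, which is absorbed into
    \<open>u0\<close>.\<close>
  define u0 where "u0 = R l f - (l - l0) *\<^sub>R R l (G l0 \<xi>)"
  have u0: "u0 \<in> Domain A" using l by (simp add: u0_def resolvent_mem Domain_diff Domain_scale)
  have u_eq: "u = u0 + G l0 \<xi>" using G_resolvent_identity[OF l l0, of \<xi>] by (simp add: u u0_def)
  have "\<tau> u0 = adjoint (G l) f - (l - l0) *\<^sub>R adjoint (G l) (G l0 \<xi>)"
    using l by (simp add: u0_def adjoint_G resolvent_mem Domain_scale \<tau>_diff \<tau>_scale)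
  also have "\<dots> = adjoint (G l) f - Q l \<xi>" by (simp add: Q_def adjoint_G_G_commute[OF l l0])
  also have "\<dots> = \<xi>'" using \<xi>'(2) by (simp add: algebra_simps)
  finally have "(\<xi>, \<tau> u0) \<in> \<Theta>" using \<xi>' by simp
  then have mem: "(u, rel_app A u0 - l0 *\<^sub>R G l0 \<xi>) \<in> A_operator A \<tau> \<Theta> l0"
    using u0 by (auto simp: A_operator_def u_eq)
  \<comment> \<open>The shift by \<open>l\<close> undoes \<open>R l\<close> in both terms of
    \<open>u0\<close>; the deficit \<open>(l - l0) *\<^sub>R G l0 \<xi>\<close> is restored by the
    \<open>G l0\<close> component of \<open>u\<close>.\<close>
  have "rel_app A u0 = rel_app A (R l f) - (l - l0) *\<^sub>R rel_app A (R l (G l0 \<xi>))"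
    using l by (simp only: u0_def resolvent_mem Domain_scale A_diff A_scale)
  then have "rel_app A u0 + l *\<^sub>R u0 =
     (rel_app A (R l f) + l *\<^sub>R R l f) - (l - l0) *\<^sub>R (rel_app A (R l (G l0 \<xi>)) + l *\<^sub>R R l (G l0 \<xi>))"
    by (simp add: u0_def algebra_simps)
  also have "\<dots> = f - (l - l0) *\<^sub>R G l0 \<xi>" using l by (simp add: shift_resolvent)
  finally have "rel_app A u0 - l0 *\<^sub>R G l0 \<xi> + l *\<^sub>R u = f" by (simp add: u_eq algebra_simps)
  with mem show ?thesis using that unfolding u_def by blast
qed

lemma A_operator_maximal: "maximal_monotone_operator_of_type l0 (A_operator A \<tau> \<Theta> l0)"
proof -
  \<comment> \<open>Any shift above \<open>l0\<close> would serve as the witness for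
    maximality.\<close>
  have l1: "l0 < l0 + 1" by simp
  have "f \<in> Range (rel_plus (A_operator A \<tau> \<Theta> l0) (\<lambda>u. (l0 + 1) *\<^sub>R u))" for f
  proof -
    obtain w where "(R_map A \<tau> \<Theta> l0 (l0 + 1) f, w) \<in> A_operator A \<tau> \<Theta> l0"
      "w + (l0 + 1) *\<^sub>R R_map A \<tau> \<Theta> l0 (l0 + 1) f = f" by (rule R_map_solves[OF l1])
    then have "(R_map A \<tau> \<Theta> l0 (l0 + 1) f, f) \<in> rel_plus (A_operator A \<tau> \<Theta> l0) (\<lambda>u. (l0 + 1) *\<^sub>R u)"
      unfolding rel_plus_def by force
    then show ?thesis by (rule RangeI)
  qed
  then have "Range (rel_plus (A_operator A \<tau> \<Theta> l0) (\<lambda>u. (l0 + 1) *\<^sub>R u)) = UNIV" by blast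
  then show ?thesis
    unfolding maximal_monotone_operator_of_type_def using A_operator_type l1 by blast
qed

text \<open>Equality of relations contains two halves: \<open>R_map_solves\<close> makes the shifted
  operator onto, and monotonicity of type \<open>l0 < l\<close> makes it injective.\<close>

lemma A_operator_resolvent:
  assumes "l0 < l"
  shows "resolvent_relation (A_operator A \<tau> \<Theta> l0) l = {(f, u). u = R_map A \<tau> \<Theta> l0 l f}"
proof -
  have "u = v" if "(u, w) \<in> A_operator A \<tau> \<Theta> l0" "(v, z) \<in> A_operator A \<tau> \<Theta> l0"
    "w + l *\<^sub>R u = z + l *\<^sub>R v" for u w v z
  proof -
    \<comment> \<open>Equal images under the shift by \<open>l\<close> leave only
      \<open>- ((l - l0) *\<^sub>R (u - v))\<close>, which monotonicity allows only for
      \<open>u = v\<close>.\<close>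
    have "w + l0 *\<^sub>R u - (z + l0 *\<^sub>R v) = (w + l *\<^sub>R u) - (z + l *\<^sub>R v) - (l - l0) *\<^sub>R (u - v)"
      by (simp add: algebra_simps)
    also have "\<dots> = - ((l - l0) *\<^sub>R (u - v))" using that(3) by simp
    finally have "(l - l0) * ((u - v) \<bullet> (u - v)) \<le> 0"
      using A_operator_monotone[OF that(1,2)] by (simp only: inner_minus_left inner_scaleR_left)
    then have "(u - v) \<bullet> (u - v) \<le> 0" using assms by (simp add: mult_le_0_iff)
    then show ?thesis by (metis inner_ge_zero inner_eq_zero_iff order_antisym right_minus_eq)
  qed
  note inj = this
  have "(f, u) \<in> resolvent_relation (A_operator A \<tau> \<Theta> l0) l \<longleftrightarrow> u = R_map A \<tau> \<Theta> l0 l f" for f u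
  proof -
    obtain w where w: "(R_map A \<tau> \<Theta> l0 l f, w) \<in> A_operator A \<tau> \<Theta> l0"
      "w + l *\<^sub>R R_map A \<tau> \<Theta> l0 l f = f" by (rule R_map_solves[OF assms])
    have "(f, u) \<in> resolvent_relation (A_operator A \<tau> \<Theta> l0) l \<longleftrightarrow>
        (\<exists>z. (u, z) \<in> A_operator A \<tau> \<Theta> l0 \<and> z + l *\<^sub>R u = f)"
      by (auto simp: resolvent_relation_def rel_plus_def)
    then show ?thesis using w inj by metis
  qed
  then show ?thesis by auto
qed

end

end

theorem theorem3p4:
  fixes S A0 :: "('a::{real_inner, complete_space} \<times> 'a) set"
    and \<tau> :: "'a \<Rightarrow> 'b::{real_inner, complete_space}"
    and \<Theta> :: "('b \<times> 'b) set"
    and \<omega> l0 :: real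
  assumes "linear_operator S" and "densely_defined S" and "symmetric_operator S"
    and "bounded_below (- \<omega>) S"
    and "\<not> essentially_selfadjoint S"
    and A0: "A0 = Friedrichs_extension S"
    and "linear_on_subspace (Domain A0) \<tau>"
    and "continuous_map (graph_topology A0) euclidean \<tau>"
    and "\<tau> ` Domain A0 = UNIV"
    and "Domain S = {u \<in> Domain A0. \<tau> u = 0}"
    and "maximal_monotone_relation \<Theta>"
    and "\<omega> < l0"
  shows "(\<forall>l \<ge> l0. maximal_monotone_relation (M_relation A0 \<tau> \<Theta> l0 l)) \<and>
    (\<forall>l > l0. \<forall>\<eta>. \<exists>!\<xi>. (\<eta>, \<xi>) \<in> (M_relation A0 \<tau> \<Theta> l0 l)\<inverse>) \<and>
    maximal_monotone_operator_of_type l0 (A_operator A0 \<tau> \<Theta> l0) \<and>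
    (\<forall>l > l0. resolvent_relation (A_operator A0 \<tau> \<Theta> l0) l = {(f, u). u = R_map A0 \<tau> \<Theta> l0 l f})"
proof -
  interpret S: semibounded_operator S \<omega> by unfold_locales fact+
  interpret boundary_map A0 \<omega> \<tau>
  proof
    show "linear_operator A0" "symmetric_operator A0" "bounded_below (- \<omega>) A0"
      by (simp_all add: A0 S.Friedrichs_linear S.Friedrichs_symmetric S.Friedrichs_bounded_below)
    show "\<exists>u w. (u, w) \<in> A0 \<and> w + l *\<^sub>R u = f" if "\<omega> < l" for l f
      using S.Friedrichs_surj[OF that] unfolding A0 by metis
    \<comment> \<open>The kernel of \<tau> is \<open>Domain S\<close>, so this is the density of
      \<open>S\<close>.\<close>
    show "closure {u \<in> Domain A0. \<tau> u = 0} = UNIV"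
      using \<open>densely_defined S\<close> \<open>Domain S = {u \<in> Domain A0. \<tau> u = 0}\<close> by (simp add: densely_defined_def)
  qed fact+
  show ?thesis
    using M_maximal_monotone M_bijective A_operator_maximal A_operator_resolvent
      \<open>maximal_monotone_relation \<Theta>\<close> \<open>\<omega> < l0\<close> by blast
qed

end
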